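(* Let $Y$ be a Banach space which is a quotient of the Schreier space $S$. Then $Y$ is $c_0$-saturated, i.e. every infinite dimensional (closed) subspace of $Y$ contains a subspace isomorphic to $c_0$.
   Context: Let $c_{00}$ be the space of finitely supported real sequences. For $x=(x_i)\in c_{00}$ set $\|x\|=\max\{\sum_{i=1}^p |x_{k_i}| : p\in\mathbb{N},\ p\le k_1<k_2<\cdots<k_p\}$. The Schreier space $S$ is the completion of $(c_{00},\|\cdot\|)$. $Y$ is a quotient of $S$ if there is a bounded linear operator from $S$ onto $Y$. *)

theory Defs
  imports "HOL-Analysis.Analysis"
begin

text \<open>Sequences are indexed from 0 here; index i stands for the paper's index i+1.
  A finite set F of indices is Schreier-admissible iff it is nonempty and
  card F \<le> (least element of F) + 1 (i.e. p \<le> k_1 in the paper's 1-based indexing).\<close>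

definition schreier_admissible :: "nat set \<Rightarrow> bool" where
  "schreier_admissible F \<longleftrightarrow> finite F \<and> F \<noteq> {} \<and> card F \<le> Min F + 1"

text \<open>Schreier norm of an arbitrary real sequence (possibly infinite, hence ereal).\<close>
definition schreier_norm :: "(nat \<Rightarrow> real) \<Rightarrow> ereal" where
  "schreier_norm x = (SUP F \<in> {F. schreier_admissible F}. ereal (\<Sum>k\<in>F. \<bar>x k\<bar>))"

definition finitely_supported :: "(nat \<Rightarrow> real) \<Rightarrow> bool" where
  "finitely_supported y \<longleftrightarrow> finite {n. y n \<noteq> 0}"

text \<open>The Schreier space S: the completion of (c00, Schreier norm), realised concretely
  as the closure of c00 in the Schreier norm.\<close>
definition schreier_space :: "(nat \<Rightarrow> real) set" where
  "schreier_space = {x. \<forall>e>0. \<exists>y. finitely_supported y \<and>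
                         schreier_norm (\<lambda>n. x n - y n) < ereal e}"

definition quotient_of_schreier :: "((nat \<Rightarrow> real) \<Rightarrow> 'a::real_normed_vector) \<Rightarrow> bool" where
  "quotient_of_schreier T \<longleftrightarrow>
     (\<forall>x\<in>schreier_space. \<forall>y\<in>schreier_space. \<forall>a b.
        T (\<lambda>n. a * x n + b * y n) = a *\<^sub>R T x + b *\<^sub>R T y) \<and>
     (\<exists>C. \<forall>x\<in>schreier_space. ereal (norm (T x)) \<le> ereal C * schreier_norm x) \<and>
     T ` schreier_space = UNIV"

definition c0_space :: "(nat \<Rightarrow> real) set" where
  "c0_space = {x. x \<longlonglongrightarrow> 0}"

definition sup_norm :: "(nat \<Rightarrow> real) \<Rightarrow> real" where
  "sup_norm x = (SUP n. \<bar>x n\<bar>)"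

definition contains_c0 :: "'a::real_normed_vector set \<Rightarrow> bool" where
  "contains_c0 Z \<longleftrightarrow> (\<exists>J :: (nat \<Rightarrow> real) \<Rightarrow> 'a.
     (\<forall>x\<in>c0_space. \<forall>y\<in>c0_space. \<forall>a b.
        J (\<lambda>n. a * x n + b * y n) = a *\<^sub>R J x + b *\<^sub>R J y) \<and>
     J ` c0_space \<subseteq> Z \<and>
     (\<exists>A B. 0 < A \<and> 0 < B \<and>
        (\<forall>x\<in>c0_space. A * sup_norm x \<le> norm (J x) \<and> norm (J x) \<le> B * sup_norm x)))"

definition infinite_dimensional :: "'a::real_vector set \<Rightarrow> bool" where
  "infinite_dimensional Z \<longleftrightarrow> \<not> (\<exists>B. finite B \<and> span B = Z)"

definition c0_saturated :: "'a::real_normed_vector set \<Rightarrow> bool" where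
  "c0_saturated Y \<longleftrightarrow> (\<forall>Z. Z \<subseteq> Y \<and> subspace Z \<and> closed Z \<and> infinite_dimensional Z
                          \<longrightarrow> contains_c0 Z)"

end

theory Submission
  imports Defs
begin

text \<open>
  Only the first half of the open mapping theorem is needed: every vector of \<open>Y\<close> has approximate
  lifts of controlled norm in \<open>c\<^sub>0\<^sub>0\<close>. Differences of lifts of a separated sequence in a subspace
  \<open>Z\<close> yield seminormalized vectors \<open>y k\<close> of \<open>Z\<close> with bounded lifts \<open>u k\<close> that are successive
  blocks of the unit vector basis. A Mazur-type selection makes the \<open>y k\<close> basic, and after thinning
  out, every bounded lift of \<open>w = \<Sum>\<^sub>k c\<^sub>k y\<^sub>k\<close> can be cut into successive pieces that lift the
  summands \<open>c\<^sub>k y\<^sub>k\<close>. The cuts are gradual: in a space as close to \<open>c\<^sub>0\<close> as the Schreier space a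
  bounded vector need not have small pieces at which to cut sharply, but bounded block sequences have
  convex combinations tending to \<open>0\<close>.

  A vector of bounded Schreier norm has boundedly many coordinates exceeding a given threshold. Hence,
  if all \<open>c\<^sub>k\<close> are small, replacing the few pieces that have a large coordinate by \<open>c\<^sub>k u\<^sub>k\<close> gives a
  bounded lift of \<open>w\<close> with small coordinates. Either the \<open>y k\<close> satisfy an upper \<open>c\<^sub>0\<close>-estimate, or
  there are normalized blocks with ever smaller coefficients; their lifts have rapidly decreasing
  coordinates and so satisfy an upper \<open>c\<^sub>0\<close>-estimate in the Schreier norm.
\<close>

subsection \<open>Finite-dimensional subspaces\<close>

lemma infdist_le_norm_add_scaleR:
  fixes b :: "'a::real_normed_vector"
  assumes "subspace S" "v \<in> S"
  shows "\<bar>a\<bar> * infdist b S \<le> norm (v + a *\<^sub>R b)"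
proof (cases "a = 0")
  case False
  have "- (1/a) *\<^sub>R v \<in> S" using assms by (rule subspace_scale)
  then have "infdist b S \<le> dist b (- (1/a) *\<^sub>R v)" by (rule infdist_le)
  also have "\<dots> = norm ((1/a) *\<^sub>R (v + a *\<^sub>R b))"
    using False by (simp add: dist_norm scaleR_add_right add.commute)
  also have "\<dots> = norm (v + a *\<^sub>R b) / \<bar>a\<bar>" by simp
  finally show ?thesis using False by (simp add: pos_le_divide_eq mult.commute)
qed simp

lemma closed_if_compact_Int_cball:
  fixes S :: "'a::real_normed_vector set"
  assumes "\<And>R. compact (S \<inter> cball 0 R)"
  shows "closed S"
  unfolding closed_sequential_limits
proof (intro allI impI, elim conjE)
  fix f l assume f: "\<forall>n. f n \<in> S" "f \<longlonglongrightarrow> l"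
  have "Bseq f" by (intro convergent_imp_Bseq convergentI[OF f(2)])
  then obtain R where "\<And>n. norm (f n) \<le> R" unfolding Bseq_def by blast
  then have "f n \<in> S \<inter> cball 0 R" for n using f by simp
  then show "l \<in> S"
    using closed_sequentially[OF compact_imp_closed[OF assms[of R]] _ f(2)] by blast
qed

lemma span_insert_Int_cball:
  fixes b :: "'a::real_normed_vector" and R :: real
  assumes dist_pos: "0 < infdist b (span B)"
  defines "r \<equiv> R / infdist b (span B)"
  shows "span (insert b B) \<inter> cball 0 R =
    (\<lambda>(v, a). v + a *\<^sub>R b) ` ((span B \<inter> cball 0 (R + r * norm b)) \<times> {-r..r}) \<inter> cball 0 R"
    (is "_ = ?S \<inter> _")
proof (intro equalityI subsetI)
  fix y assume y: "y \<in> span (insert b B) \<inter> cball 0 R"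
  then obtain a where a: "y - a *\<^sub>R b \<in> span B" unfolding span_insert by blast
  have "\<bar>a\<bar> * infdist b (span B) \<le> R"
    using infdist_le_norm_add_scaleR[OF subspace_span a, of a b] y by simp
  then have "\<bar>a\<bar> \<le> r" unfolding r_def using dist_pos by (simp add: pos_le_divide_eq)
  moreover have "norm (y - a *\<^sub>R b) \<le> norm y + \<bar>a\<bar> * norm b"
    using norm_triangle_ineq4[of y "a *\<^sub>R b"] by simp
  moreover have "\<bar>a\<bar> * norm b \<le> r * norm b" using \<open>\<bar>a\<bar> \<le> r\<close> by (rule mult_right_mono) simp
  ultimately have "(y - a *\<^sub>R b, a) \<in> (span B \<inter> cball 0 (R + r * norm b)) \<times> {-r..r}"
    using a y by (auto simp: abs_le_iff)
  then have "y \<in> ?S" by (rule image_eqI[rotated]) simp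
  then show "y \<in> ?S \<inter> cball 0 R" using y by blast
next
  fix y assume y: "y \<in> ?S \<inter> cball 0 R"
  then obtain v a where "v \<in> span B" "y = v + a *\<^sub>R b" by auto
  then have "y - a *\<^sub>R b \<in> span B" by simp
  then show "y \<in> span (insert b B) \<inter> cball 0 R" using y unfolding span_insert by blast
qed

lemma compact_span_cball:
  fixes B :: "'a::real_normed_vector set"
  assumes "finite B"
  shows "compact (span B \<inter> cball 0 R)"
  using assms
proof (induction B arbitrary: R rule: finite_induct)
  case empty
  show ?case by (rule finite_imp_compact) simp
next
  case (insert b B)
  show ?case
  proof (cases "b \<in> span B")
    case True
    then show ?thesis using insert.IH by (simp add: span_redundant)
  next
    case False
    have "closed (span B)" using insert.IH by (rule closed_if_compact_Int_cball)
    then have "0 < infdist b (span B)"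
      using False span_zero[of B] by (intro infdist_pos_not_in_closed) auto
    moreover have "compact ((\<lambda>(v, a). v + a *\<^sub>R b) ` ((span B \<inter> cball 0 R') \<times> {-r..r}))" for r R'
      by (intro compact_continuous_image compact_Times insert.IH compact_Icc)
        (simp add: case_prod_unfold, intro continuous_intros)
    ultimately show ?thesis by (simp add: span_insert_Int_cball compact_Int_closed)
  qed
qed

lemma closed_span_finite:
  fixes B :: "'a::real_normed_vector set"
  shows "finite B \<Longrightarrow> closed (span B)"
  by (intro closed_if_compact_Int_cball compact_span_cball)

lemma riesz_lemma:
  fixes V :: "'a::real_normed_vector set"
  assumes V: "subspace V" "closed V" and Z: "subspace Z" "V \<subset> Z" and \<theta>: "0 < \<theta>" "\<theta> < 1"
  obtains r where "r \<in> Z" "norm r = 1" "\<And>v. v \<in> V \<Longrightarrow> \<theta> \<le> norm (r - v)"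
proof -
  obtain z where z: "z \<in> Z" "z \<notin> V" using Z(2) by blast
  have "V \<noteq> {}" using subspace_0[OF V(1)] by blast
  then have pos: "0 < infdist z V" using V(2) z(2) by (intro infdist_pos_not_in_closed)
  then have "infdist z V < infdist z V / \<theta>" using \<theta> by (simp add: field_simps)
  then obtain v where v: "v \<in> V" "dist z v < infdist z V / \<theta>"
    unfolding infdist_notempty[OF \<open>V \<noteq> {}\<close>]
    using cINF_less_iff[of V "dist z"] \<open>V \<noteq> {}\<close> by (metis bdd_belowI2 zero_le_dist)
  define n where "n = norm (z - v)"
  have n: "0 < n" using z(2) v(1) by (auto simp: n_def)
  have near: "n * \<theta> < infdist z V" using v(2) \<theta>(1) by (simp add: n_def dist_norm pos_less_divide_eq)
  show thesis
  proof
    show "(1 / n) *\<^sub>R (z - v) \<in> Z"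
      using Z z(1) v(1) by (intro subspace_scale subspace_diff) auto
    show "norm ((1 / n) *\<^sub>R (z - v)) = 1" using n by (simp add: n_def)
  next
    fix v' assume "v' \<in> V"
    then have "- (v + n *\<^sub>R v') \<in> V" using V(1) v(1) by (intro subspace_neg subspace_add subspace_scale)
    from infdist_le_norm_add_scaleR[OF V(1) this, of 1 z]
    have "infdist z V \<le> norm (n *\<^sub>R ((1 / n) *\<^sub>R (z - v) - v'))"
      using n by (simp add: scaleR_diff_right algebra_simps)
    also have "\<dots> = n * norm ((1 / n) *\<^sub>R (z - v) - v')" using n by simp
    finally show "\<theta> \<le> norm ((1 / n) *\<^sub>R (z - v) - v')"
      using near n by (meson le_less_trans less_imp_le less_le_trans mult_less_cancel_left_pos not_le)
  qed
qed

lemma infinite_dimensional_separated_sequence: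
  fixes Z :: "'a::real_normed_vector set"
  assumes Z: "subspace Z" "infinite_dimensional Z" and \<theta>: "0 < \<theta>" "\<theta> < 1"
  obtains z :: "nat \<Rightarrow> 'a" where "\<And>n. z n \<in> Z" "\<And>n. norm (z n) = 1"
    "\<And>m n. m \<noteq> n \<Longrightarrow> \<theta> \<le> norm (z m - z n)"
proof -
  let ?P = "\<lambda>(f :: nat \<Rightarrow> 'a) n r. r \<in> Z \<and> norm r = 1 \<and> (\<forall>m<n. \<theta> \<le> norm (r - f m))"
  have "\<exists>f. \<forall>n. ?P f n (f n)"
  proof (rule dependent_wellorder_choice[where P = ?P])
    fix n :: nat and f :: "nat \<Rightarrow> 'a"
    assume f: "\<And>m. m < n \<Longrightarrow> ?P f m (f m)"
    have "span (f ` {..<n}) \<subseteq> Z" using f Z(1) by (intro span_minimal) auto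
    moreover have "span (f ` {..<n}) \<noteq> Z" using Z(2) unfolding infinite_dimensional_def by blast
    ultimately obtain r where "r \<in> Z" "norm r = 1" "\<And>v. v \<in> span (f ` {..<n}) \<Longrightarrow> \<theta> \<le> norm (r - v)"
      using riesz_lemma[OF subspace_span closed_span_finite Z(1) psubsetI \<theta>] by blast
    moreover have "f m \<in> span (f ` {..<n})" if "m < n" for m using that by (intro span_base) auto
    ultimately show "\<exists>r. ?P f n r" by blast
  qed auto
  then obtain z where z: "\<And>n. ?P z n (z n)" by blast
  have "\<theta> \<le> norm (z m - z n)" if "m \<noteq> n" for m n
    using z[of m] z[of n] that by (cases m n rule: linorder_cases) (auto simp: norm_minus_commute)
  with z show thesis by (intro that[of z]) auto
qed

lemma compact_sequence_close_terms:
  fixes f :: "nat \<Rightarrow> 'a::metric_space"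
  assumes "compact S" "range f \<subseteq> S" "0 < \<epsilon>"
  obtains p q where "p \<noteq> q" "dist (f p) (f q) < \<epsilon>"
proof -
  obtain l r where r: "strict_mono r" "(f \<circ> r) \<longlonglongrightarrow> l"
    using assms(1,2) unfolding compact_def by blast
  then have "Cauchy (f \<circ> r)" by (intro LIMSEQ_imp_Cauchy)
  then obtain N where "\<And>m n. N \<le> m \<Longrightarrow> N \<le> n \<Longrightarrow> dist ((f \<circ> r) m) ((f \<circ> r) n) < \<epsilon>"
    using assms(3) unfolding Cauchy_def by blast
  then have "dist (f (r N)) (f (r (Suc N))) < \<epsilon>" by simp
  moreover have "r N \<noteq> r (Suc N)" using r(1) by (simp add: strict_mono_eq)
  ultimately show thesis by (rule that[rotated])
qed

subsection \<open>Sublinear costs and approximate preimages\<close>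

locale sublinear_cost =
  fixes cost :: "'a::real_normed_vector \<Rightarrow> real \<Rightarrow> bool"
  assumes cost_nonneg: "cost y s \<Longrightarrow> 0 \<le> s"
    and cost_add: "cost y s \<Longrightarrow> cost z t \<Longrightarrow> cost (y + z) (s + t)"
    and cost_scaleR: "cost y s \<Longrightarrow> cost (a *\<^sub>R y) (\<bar>a\<bar> * s)"

lemma interior_nonempty_of_closed_cover:
  fixes A :: "nat \<Rightarrow> 'a::complete_space set"
  assumes "\<And>n. closed (A n)" "interior (\<Union>n. A n) \<noteq> {}"
  obtains n where "interior (A n) \<noteq> {}"
proof (rule ccontr)
  assume "\<not> thesis"
  then have "interior (A n) = {}" for n using that by blast
  then have "euclidean interior_of (\<Union>(range A)) = {}"
    using assms(1)
    by (intro Baire_category_alt disjI1 completely_metrizable_space_euclidean) auto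
  then show False using assms(2) by simp
qed

lemma sublinear_cost_closure:
  assumes "sublinear_cost cost"
  shows "sublinear_cost (\<lambda>y s. y \<in> closure {z. cost z s})"
proof
  interpret sublinear_cost cost by fact
  show "0 \<le> s" if "y \<in> closure {z. cost z s}" for y s
    using that cost_nonneg by (cases "{z. cost z s} = {}") auto
  fix y s assume y: "y \<in> closure {z. cost z s}"
  then obtain f where f: "\<And>n. cost (f n) s" "f \<longlonglongrightarrow> y" unfolding closure_sequential by blast
  show "a *\<^sub>R y \<in> closure {z. cost z (\<bar>a\<bar> * s)}" for a
    unfolding closure_sequential using f
    by (intro exI[of _ "\<lambda>n. a *\<^sub>R f n"]) (auto intro: cost_scaleR tendsto_intros)
  fix z t assume "z \<in> closure {z. cost z t}"
  then obtain g where "\<And>n. cost (g n) t" "g \<longlonglongrightarrow> z" unfolding closure_sequential by blast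
  with f show "y + z \<in> closure {z. cost z (s + t)}"
    unfolding closure_sequential
    by (intro exI[of _ "\<lambda>n. f n + g n"]) (auto intro: cost_add tendsto_intros)
qed

text \<open>The first half of the open mapping theorem.\<close>

lemma sublinear_cost_approximate_preimages:
  fixes cost :: "'a::banach \<Rightarrow> real \<Rightarrow> bool"
  assumes "sublinear_cost cost" and cover: "\<And>y. \<exists>n. y \<in> closure {z. cost z (real n)}"
  obtains K where "0 \<le> K" "\<And>y. y \<in> closure {z. cost z (K * norm y)}"
proof -
  interpret closure: sublinear_cost "\<lambda>y s. y \<in> closure {z. cost z s}"
    using assms(1) by (rule sublinear_cost_closure)
  obtain n where "interior (closure {z. cost z (real n)}) \<noteq> {}"
    by (rule interior_nonempty_of_closed_cover[of "\<lambda>n. closure {z. cost z (real n)}"])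
      (use cover in \<open>auto simp: UNION_eq\<close>)
  then obtain y0 r where r: "0 < r" "ball y0 r \<subseteq> closure {z. cost z (real n)}"
    by (auto simp: mem_interior)
  have ball: "y \<in> closure {z. cost z (real n)}" if "norm y < r" for y
  proof -
    have "y0 + y \<in> closure {z. cost z (real n)}" "y0 - y \<in> closure {z. cost z (real n)}"
      using r(2) that by (auto simp: subset_iff dist_norm)
    then have "(1/2) *\<^sub>R (y0 + y) + (-1/2) *\<^sub>R (y0 - y) \<in> closure {z. cost z (\<bar>1/2\<bar> * n + \<bar>-1/2\<bar> * n)}"
      by (intro closure.cost_add closure.cost_scaleR)
    moreover have "y = (1/2) *\<^sub>R (y0 + y) + (-1/2) *\<^sub>R (y0 - y)"
      using scaleR_half_double[of y] by (simp add: algebra_simps)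
    ultimately show ?thesis by simp
  qed
  show thesis
  proof (rule that[of "2 * real n / r"])
    show "0 \<le> 2 * real n / r" using r(1) by simp
    fix y :: 'a
    define a where "a = 2 * norm y / r"
    have "\<exists>z. norm z < r \<and> y = a *\<^sub>R z"
    proof (cases "y = 0")
      case False
      then show ?thesis using r(1) by (intro exI[of _ "(1 / a) *\<^sub>R y"]) (simp add: a_def)
    qed (use r(1) in \<open>auto simp: a_def intro: exI[of _ 0]\<close>)
    then obtain z where "norm z < r" "y = a *\<^sub>R z" by blast
    then have "y \<in> closure {z. cost z (\<bar>a\<bar> * n)}" using ball closure.cost_scaleR by blast
    then show "y \<in> closure {z. cost z (2 * real n / r * norm y)}"
      using r(1) by (simp add: a_def mult_ac)
  qed
qed

definition cost_gauge :: "('a \<Rightarrow> real \<Rightarrow> bool) \<Rightarrow> 'a \<Rightarrow> real" where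
  "cost_gauge cost y = Inf {s. cost y s}"

context sublinear_cost
begin

lemma cost_gauge_le: "cost y s \<Longrightarrow> cost_gauge cost y \<le> s"
  unfolding cost_gauge_def by (rule cInf_lower) (auto intro: bdd_belowI[of _ 0] cost_nonneg)

lemma cost_gauge_less_iff:
  assumes "\<exists>s. cost y s"
  shows "cost_gauge cost y < t \<longleftrightarrow> (\<exists>s<t. cost y s)"
proof -
  have "bdd_below {s. cost y s}" by (auto intro: bdd_belowI[of _ 0] cost_nonneg)
  then show ?thesis
    unfolding cost_gauge_def using assms by (subst cInf_less_iff) auto
qed

lemma cost_gauge_add:
  assumes total: "\<And>y. \<exists>s. cost y s"
  shows "cost_gauge cost (y + z) \<le> cost_gauge cost y + cost_gauge cost z"
proof (rule field_le_epsilon)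
  fix \<epsilon> :: real assume "0 < \<epsilon>"
  then have "cost_gauge cost y < cost_gauge cost y + \<epsilon>/2" "cost_gauge cost z < cost_gauge cost z + \<epsilon>/2"
    by simp_all
  then obtain s t where "cost y s" "s < cost_gauge cost y + \<epsilon>/2"
    and "cost z t" "t < cost_gauge cost z + \<epsilon>/2"
    unfolding cost_gauge_less_iff[OF total] by blast
  then show "cost_gauge cost (y + z) \<le> cost_gauge cost y + cost_gauge cost z + \<epsilon>"
    using cost_gauge_le[OF cost_add[of y s z t]] by simp
qed

lemma cost_gauge_nonneg:
  assumes "\<exists>s. cost y s"
  shows "0 \<le> cost_gauge cost y"
  unfolding cost_gauge_def using assms by (intro cInf_greatest) (auto dest: cost_nonneg)

lemma cost_gauge_scaleR_le:
  assumes total: "\<And>y. \<exists>s. cost y s"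
  shows "cost_gauge cost (a *\<^sub>R y) \<le> \<bar>a\<bar> * cost_gauge cost y"
proof (rule field_le_epsilon)
  fix \<epsilon> :: real assume \<epsilon>: "0 < \<epsilon>"
  then have "cost_gauge cost y < cost_gauge cost y + \<epsilon> / (\<bar>a\<bar> + 1)" by (simp add: add_nonneg_pos)
  then obtain s where s: "cost y s" "s < cost_gauge cost y + \<epsilon> / (\<bar>a\<bar> + 1)"
    unfolding cost_gauge_less_iff[OF total] by blast
  have "cost_gauge cost (a *\<^sub>R y) \<le> \<bar>a\<bar> * s" using s(1) by (intro cost_gauge_le cost_scaleR)
  also have "\<dots> \<le> \<bar>a\<bar> * (cost_gauge cost y + \<epsilon> / (\<bar>a\<bar> + 1))"
    using s(2) by (intro mult_left_mono) auto
  also have "\<dots> \<le> \<bar>a\<bar> * cost_gauge cost y + \<epsilon>"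
    using \<epsilon> by (simp add: field_simps add_nonneg_pos)
  finally show "cost_gauge cost (a *\<^sub>R y) \<le> \<bar>a\<bar> * cost_gauge cost y + \<epsilon>" .
qed

lemma cost_gauge_scaleR:
  assumes total: "\<And>y. \<exists>s. cost y s"
  shows "cost_gauge cost (a *\<^sub>R y) = \<bar>a\<bar> * cost_gauge cost y"
proof (cases "a = 0")
  case True
  then show ?thesis
    using cost_gauge_scaleR_le[OF total, of 0 y] cost_gauge_nonneg[OF total, of 0] by simp
next
  case False
  have "cost_gauge cost ((1/a) *\<^sub>R (a *\<^sub>R y)) \<le> \<bar>1/a\<bar> * cost_gauge cost (a *\<^sub>R y)"
    by (rule cost_gauge_scaleR_le[OF total])
  then have "\<bar>a\<bar> * cost_gauge cost y \<le> cost_gauge cost (a *\<^sub>R y)" using False by (simp add: field_simps)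
  with cost_gauge_scaleR_le[OF total, of a y] show ?thesis by (rule antisym)
qed

end

subsection \<open>Equivalent norms and Mazur's selection of basic sequences\<close>

definition equivalent_norm :: "('a::real_normed_vector \<Rightarrow> real) \<Rightarrow> bool" where
  "equivalent_norm p \<longleftrightarrow> (\<forall>x y. p (x + y) \<le> p x + p y) \<and> (\<forall>a x. p (a *\<^sub>R x) = \<bar>a\<bar> * p x) \<and>
     (\<exists>A>0. \<forall>x. A * norm x \<le> p x) \<and> (\<exists>B. \<forall>x. p x \<le> B * norm x)"

context
  fixes p :: "'a::real_normed_vector \<Rightarrow> real"
  assumes p: "equivalent_norm p"
begin

lemma equivalent_norm_triangle: "p (x + y) \<le> p x + p y"
  and equivalent_norm_scaleR: "p (a *\<^sub>R x) = \<bar>a\<bar> * p x"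
  using p by (simp_all add: equivalent_norm_def)

lemma equivalent_norm_nonneg: "0 \<le> p x"
proof -
  obtain A where "0 < A" "A * norm x \<le> p x" using p unfolding equivalent_norm_def by blast
  then show ?thesis by (meson less_imp_le mult_nonneg_nonneg norm_ge_zero order_trans)
qed

lemma equivalent_norm_continuous: "continuous_on S p"
proof -
  obtain B where B: "\<And>x. p x \<le> B * norm x" using p unfolding equivalent_norm_def by blast
  have diff: "p x - p y \<le> \<bar>B\<bar> * dist x y" for x y
  proof -
    have "p x - p y \<le> p (x - y)" using equivalent_norm_triangle[of y "x - y"] by simp
    also have "\<dots> \<le> \<bar>B\<bar> * dist x y"
      unfolding dist_norm by (rule order_trans[OF B]) (simp add: mult_right_mono)
    finally show ?thesis .
  qed
  have "\<bar>B\<bar>-lipschitz_on S p"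
    using diff by (intro lipschitz_onI) (auto simp: dist_real_def abs_le_iff, metis dist_commute)
  then show ?thesis by (rule lipschitz_on_continuous_on)
qed

lemma convex_equivalent_norm_sublevel: "convex {z. p (x + t *\<^sub>R z) \<le> c}"
proof (rule convexI, clarify)
  fix y z and a b :: real
  assume y: "p (x + t *\<^sub>R y) \<le> c" and z: "p (x + t *\<^sub>R z) \<le> c" and ab: "0 \<le> a" "0 \<le> b" "a + b = 1"
  have "x + t *\<^sub>R (a *\<^sub>R y + b *\<^sub>R z) = a *\<^sub>R (x + t *\<^sub>R y) + b *\<^sub>R (x + t *\<^sub>R z)"
    using ab(3) by (simp add: algebra_simps flip: scaleR_add_left)
  then have "p (x + t *\<^sub>R (a *\<^sub>R y + b *\<^sub>R z)) \<le> a * p (x + t *\<^sub>R y) + b * p (x + t *\<^sub>R z)"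
    using equivalent_norm_triangle[of "a *\<^sub>R (x + t *\<^sub>R y)" "b *\<^sub>R (x + t *\<^sub>R z)"] ab
    by (simp add: equivalent_norm_scaleR)
  also have "\<dots> \<le> c" using y z ab by (intro convex_bound_le)
  finally show "p (x + t *\<^sub>R (a *\<^sub>R y + b *\<^sub>R z)) \<le> c" .
qed

lemma closed_equivalent_norm_sublevel: "closed {z. p (x + t *\<^sub>R z) \<le> c}"
  by (intro closed_Collect_le continuous_on_compose2[OF equivalent_norm_continuous[of UNIV]]
      continuous_intros) auto

end

lemma compact_span_equivalent_norm_sublevel:
  assumes p: "equivalent_norm p" and G: "finite G"
  shows "compact {v \<in> span G. p v \<le> R}"
proof -
  obtain A where A: "0 < A" "\<And>x. A * norm x \<le> p x" using p unfolding equivalent_norm_def by blast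
  have "norm v \<le> R / A" if "p v \<le> R" for v
    using A(1) order_trans[OF A(2) that] by (simp add: pos_le_divide_eq mult.commute)
  then have "{v \<in> span G. p v \<le> R} = (span G \<inter> cball 0 (R / A)) \<inter> {v. p (0 + 1 *\<^sub>R v) \<le> R}" by auto
  moreover have "compact ((span G \<inter> cball 0 (R / A)) \<inter> {v. p (0 + 1 *\<^sub>R v) \<le> R})"
    by (intro compact_Int_closed compact_span_cball closed_equivalent_norm_sublevel p G)
  ultimately show ?thesis by simp
qed

definition seminormalized :: "(nat \<Rightarrow> 'a::real_normed_vector) \<Rightarrow> bool" where
  "seminormalized y \<longleftrightarrow> (\<exists>A>0. \<exists>B. \<forall>k. A \<le> norm (y k) \<and> norm (y k) \<le> B)"

definition convexly_null :: "(nat \<Rightarrow> 'a::real_normed_vector) \<Rightarrow> bool" where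
  "convexly_null y \<longleftrightarrow> (\<forall>s :: nat \<Rightarrow> nat. strict_mono s \<longrightarrow> 0 \<in> closure (convex hull (range (y \<circ> s))))"

lemma convexly_null_subseq: "convexly_null y \<Longrightarrow> strict_mono s \<Longrightarrow> convexly_null (y \<circ> s)"
  unfolding convexly_null_def by (metis comp_assoc strict_mono_o)

lemma equivalent_norm_le_limit_perturbation:
  assumes p: "equivalent_norm p" and y: "seminormalized y" "convexly_null y"
    and lim: "v \<longlonglongrightarrow> v'" "t \<longlonglongrightarrow> t'" and le: "\<And>n. p (v n + t n *\<^sub>R y n) \<le> c"
  shows "p v' \<le> c"
proof (rule field_le_epsilon)
  fix \<epsilon> :: real assume "0 < \<epsilon>"
  obtain B where "\<And>n. norm (y n) \<le> B" using y(1) unfolding seminormalized_def by blast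
  moreover have "(\<lambda>n. t' - t n) \<longlonglongrightarrow> 0" using tendsto_diff[OF tendsto_const lim(2), of t'] by simp
  ultimately have "(\<lambda>n. (t' - t n) *\<^sub>R y n) \<longlonglongrightarrow> 0"
    by (intro lim_null_scaleR_bounded[where B = B]) auto
  then have "(\<lambda>n. (v' - v n) + (t' - t n) *\<^sub>R y n) \<longlonglongrightarrow> v' - v' + 0"
    by (intro tendsto_intros lim)
  then have "(\<lambda>n. p ((v' - v n) + (t' - t n) *\<^sub>R y n)) \<longlonglongrightarrow> p 0"
    using equivalent_norm_continuous[OF p, of UNIV] by (auto intro: continuous_on_tendsto_compose)
  moreover have "p 0 = 0" using equivalent_norm_scaleR[OF p, of 0 0] by simp
  ultimately have "\<forall>\<^sub>F n in sequentially. p ((v' - v n) + (t' - t n) *\<^sub>R y n) < \<epsilon>"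
    using \<open>0 < \<epsilon>\<close> by (simp add: order_tendstoD(2))
  then obtain N where N: "\<And>n. N \<le> n \<Longrightarrow> p ((v' - v n) + (t' - t n) *\<^sub>R y n) < \<epsilon>"
    unfolding eventually_sequentially by blast
  define s where "s n = n + N" for n :: nat
  have "p (v' + t' *\<^sub>R y (s n)) \<le> c + \<epsilon>" for n
  proof -
    have "v' + t' *\<^sub>R y (s n)
        = (v (s n) + t (s n) *\<^sub>R y (s n)) + ((v' - v (s n)) + (t' - t (s n)) *\<^sub>R y (s n))"
      by (simp add: algebra_simps)
    then have "p (v' + t' *\<^sub>R y (s n))
        \<le> p (v (s n) + t (s n) *\<^sub>R y (s n)) + p ((v' - v (s n)) + (t' - t (s n)) *\<^sub>R y (s n))"
      by (metis equivalent_norm_triangle[OF p])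
    also have "\<dots> \<le> c + \<epsilon>" using N by (intro add_mono le less_imp_le) (simp add: s_def)
    finally show ?thesis .
  qed
  then have "closure (convex hull (range (y \<circ> s))) \<subseteq> {z. p (v' + t' *\<^sub>R z) \<le> c + \<epsilon>}"
    by (intro closure_minimal hull_minimal convex_equivalent_norm_sublevel
        closed_equivalent_norm_sublevel p) auto
  moreover have "0 \<in> closure (convex hull (range (y \<circ> s)))"
    using y(2) unfolding convexly_null_def by (simp add: s_def strict_mono_def)
  ultimately show "p v' \<le> c + \<epsilon>" by auto
qed

lemma bounded_perturbation_coefficients:
  assumes p: "equivalent_norm p" and y: "seminormalized y"
  obtains R where "\<And>v t k. p v \<le> 1 \<Longrightarrow> p (v + t *\<^sub>R y k) \<le> 1 \<Longrightarrow> norm v \<le> R \<and> \<bar>t\<bar> \<le> R"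
proof -
  note p_scaleR = equivalent_norm_scaleR[OF p]
  obtain A where A: "0 < A" "\<And>x. A * norm x \<le> p x" using p unfolding equivalent_norm_def by blast
  obtain a where a: "0 < a" "\<And>n. a \<le> norm (y n)" using y unfolding seminormalized_def by blast
  have "norm v \<le> max (1 / A) (2 / (A * a)) \<and> \<bar>t\<bar> \<le> max (1 / A) (2 / (A * a))"
    if v: "p v \<le> 1" "p (v + t *\<^sub>R y k) \<le> 1" for v t k
  proof -
    have "norm v \<le> 1 / A"
      using A(1) order_trans[OF A(2) v(1)] by (simp add: pos_le_divide_eq mult.commute)
    moreover have "\<bar>t\<bar> * (A * a) \<le> \<bar>t\<bar> * (A * norm (y k))" using a A(1) by (intro mult_left_mono) auto
    then have "\<bar>t\<bar> * (A * a) \<le> p (t *\<^sub>R y k)"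
      unfolding p_scaleR by (rule order_trans) (intro mult_left_mono A(2) abs_ge_zero)
    moreover have "p (t *\<^sub>R y k) \<le> p (v + t *\<^sub>R y k) + p (-1 *\<^sub>R v)"
      using equivalent_norm_triangle[OF p, of "v + t *\<^sub>R y k" "-1 *\<^sub>R v"] by simp
    ultimately have "norm v \<le> 1 / A" "\<bar>t\<bar> * (A * a) \<le> 2" using v unfolding p_scaleR by simp_all
    then show ?thesis using A(1) a(1) by (simp add: pos_le_divide_eq le_max_iff_disj)
  qed
  then show thesis by (rule that)
qed

lemma mazur_eventually:
  assumes p: "equivalent_norm p" and y: "seminormalized y" "convexly_null y"
    and G: "finite G" and \<theta>: "\<theta> < 1"
  shows "\<forall>\<^sub>F k in sequentially. \<forall>v\<in>span G. \<forall>t. \<theta> * p v \<le> p (v + t *\<^sub>R y k)"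
proof (rule ccontr)
  note p_scaleR = equivalent_norm_scaleR[OF p]
  define bad where "bad k v t \<longleftrightarrow> v \<in> span G \<and> p v = 1 \<and> p (v + t *\<^sub>R y k) \<le> \<theta>" for k v t
  assume "\<not> ?thesis"
  then have "\<exists>\<^sub>F k in sequentially. \<exists>v t. bad k v t"
  proof (unfold not_eventually, elim frequently_elim1, clarsimp simp: not_le)
    fix k v t assume v: "v \<in> span G" "p (v + t *\<^sub>R y k) < \<theta> * p v"
    have "p v \<noteq> 0" using v(2) equivalent_norm_nonneg[OF p, of "v + t *\<^sub>R y k"] by auto
    then have pv: "0 < p v" using equivalent_norm_nonneg[OF p, of v] by simp
    have "p ((1 / p v) *\<^sub>R v + (t / p v) *\<^sub>R y k) = p (v + t *\<^sub>R y k) / p v"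
      using p_scaleR[of "1 / p v" "v + t *\<^sub>R y k"] pv by (simp add: scaleR_add_right)
    also have "\<dots> \<le> \<theta>" using v(2) pv by (simp add: pos_divide_le_eq)
    finally have "bad k ((1 / p v) *\<^sub>R v) (t / p v)"
      using v(1) pv by (simp add: bad_def span_scale p_scaleR)
    then show "\<exists>v t. bad k v t" by blast
  qed
  then have "infinite {k. \<exists>v t. bad k v t}"
    by (simp add: frequently_cofinite flip: cofinite_eq_sequentially)
  then obtain k :: "nat \<Rightarrow> nat" where k: "strict_mono k" "\<And>n. \<exists>v t. bad (k n) v t"
    using infinite_enumerate[of "{k. \<exists>v t. bad k v t}"] by auto
  then obtain v t where vt: "\<And>n. bad (k n) (v n) (t n)" by metis
  obtain R where R: "\<And>v t k. p v \<le> 1 \<Longrightarrow> p (v + t *\<^sub>R y k) \<le> 1 \<Longrightarrow> norm v \<le> R \<and> \<bar>t\<bar> \<le> R"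
    using bounded_perturbation_coefficients[OF p y(1)] by blast
  have "(v n, t n) \<in> (span G \<inter> cball 0 R) \<times> cball 0 R" for n
    using vt[of n] R[of "v n" "t n" "k n"] \<theta> by (simp add: bad_def)
  moreover have "compact ((span G \<inter> cball 0 R) \<times> cball (0 :: real) R)"
    by (intro compact_Times compact_span_cball G compact_cball)
  ultimately obtain l r where r: "strict_mono r" "((\<lambda>n. (v n, t n)) \<circ> r) \<longlonglongrightarrow> l"
    unfolding compact_def by (metis (no_types, lifting))
  have lim: "(v \<circ> r) \<longlonglongrightarrow> fst l" "(t \<circ> r) \<longlonglongrightarrow> snd l"
    using tendsto_fst[OF r(2)] tendsto_snd[OF r(2)] by (simp_all add: o_def)
  have "(\<lambda>n. p ((v \<circ> r) n)) \<longlonglongrightarrow> p (fst l)"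
    using continuous_on_tendsto_compose[OF equivalent_norm_continuous[OF p, of UNIV] lim(1)] by simp
  then have "p (fst l) = 1" using vt by (simp add: bad_def LIMSEQ_const_iff)
  have "p (fst l) \<le> \<theta>"
  proof (rule equivalent_norm_le_limit_perturbation[OF p _ _ lim])
    show "seminormalized (y \<circ> (k \<circ> r))" using y(1) unfolding seminormalized_def by fastforce
    show "convexly_null (y \<circ> (k \<circ> r))"
      using y(2) k(1) r(1) by (intro convexly_null_subseq strict_mono_o)
    show "p ((v \<circ> r) n + (t \<circ> r) n *\<^sub>R (y \<circ> (k \<circ> r)) n) \<le> \<theta>" for n
      using vt by (simp add: bad_def)
  qed
  with \<open>p (fst l) = 1\<close> \<theta> show False by simp
qed

lemma span_image_greaterThan_bounded:
  fixes f :: "nat \<Rightarrow> 'a::real_vector"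
  assumes "r \<in> span (f ` {j<..})"
  obtains n where "r \<in> span (f ` {j<..n})"
proof -
  obtain B c where B: "finite B" "B \<subseteq> f ` {j<..}" "r = (\<Sum>b\<in>B. c b *\<^sub>R b)"
    using assms unfolding span_explicit by blast
  then obtain F where F: "F \<subseteq> {j<..}" "finite F" "B = f ` F"
    using finite_subset_image[OF B(1,2)] by blast
  have "F \<subseteq> {j<..Max F}" using F by auto
  then have "B \<subseteq> f ` {j<..Max F}" unfolding F(3) by (rule image_mono)
  then have "r \<in> span (f ` {j<..Max F})" unfolding B(3) by (intro span_sum span_scale span_base) auto
  then show thesis by (rule that)
qed

lemma mazur_telescope:
  fixes z :: "nat \<Rightarrow> 'a::real_vector" and p :: "'a \<Rightarrow> real"
  assumes step: "\<And>i v t. j \<le> i \<Longrightarrow> v \<in> span (G \<union> z ` {..i}) \<Longrightarrow>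
      g i * p v \<le> g (Suc i) * p (v + t *\<^sub>R z (Suc i))"
    and v: "v \<in> span (G \<union> z ` {..j})" and r: "r \<in> span (z ` {j<..j + q})"
  shows "g j * p v \<le> g (j + q) * p (v + r)"
  using r
proof (induction q arbitrary: r)
  case 0
  then show ?case by simp
next
  case (Suc q)
  have "{j<..j + Suc q} = insert (Suc (j + q)) {j<..j + q}" by auto
  then obtain t where r': "r - t *\<^sub>R z (Suc (j + q)) \<in> span (z ` {j<..j + q})" (is "?r \<in> _")
    using Suc.prems by (auto simp: span_breakdown_eq)
  have "v + ?r \<in> span (G \<union> z ` {..j + q})"
    by (intro span_add subsetD[OF span_mono v] subsetD[OF span_mono r']) auto
  then have "g (j + q) * p (v + ?r) \<le> g (Suc (j + q)) * p (v + ?r + t *\<^sub>R z (Suc (j + q)))"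
    by (intro step) simp
  then show ?case using Suc.IH[OF r'] by (simp add: algebra_simps)
qed

lemma mazur_subsequence:
  fixes p :: "nat \<Rightarrow> 'a::real_normed_vector \<Rightarrow> real" and e y :: "nat \<Rightarrow> 'a"
  assumes p: "\<And>m. equivalent_norm (p m)" and y: "seminormalized y" "convexly_null y"
  obtains s where "strict_mono s"
    "\<And>m j v r. m \<le> j \<Longrightarrow> v \<in> span (e ` {..j} \<union> (y \<circ> s) ` {..j}) \<Longrightarrow>
      r \<in> span ((y \<circ> s) ` {j<..}) \<Longrightarrow> p m v \<le> 2 * p m (v + r)"
proof -
  define g where "g j = 2 - 1 / (real j + 1)" for j :: nat
  have g: "1 \<le> g j" "g j \<le> 2" "g j < g (Suc j)" for j by (simp_all add: g_def field_simps)
  define V where "V j n = span (e ` {..j} \<union> y ` {..n})" for j n :: nat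
  define stable where "stable j n k \<longleftrightarrow>
    (\<forall>m\<in>{..j}. \<forall>v\<in>V j n. \<forall>t. g j * p m v \<le> g (Suc j) * p m (v + t *\<^sub>R y k))" for j n k
  have "\<exists>k. n < k \<and> stable j n k" for j n
  proof -
    have "g j / g (Suc j) < 1" using g[of j] g[of "Suc j"] by simp
    then have "\<forall>\<^sub>F k in sequentially. \<forall>v\<in>V j n. \<forall>t. g j / g (Suc j) * p m v \<le> p m (v + t *\<^sub>R y k)" for m
      unfolding V_def by (intro mazur_eventually p y) auto
    then have "\<forall>\<^sub>F k in sequentially. stable j n k"
      unfolding stable_def using g(1)[of "Suc j"]
      by (intro eventually_ball_finite[OF finite_atMost] ballI) (auto simp: field_simps)
    from eventually_happens'[OF _ eventually_conj[OF eventually_gt_at_top[of n] this]]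
    show ?thesis by auto
  qed
  then obtain s where s: "\<And>j. s j < s (Suc j)" "\<And>j. stable j (s j) (s (Suc j))"
    using dependent_nat_choice[of "\<lambda>_ _. True" "\<lambda>j n k. n < k \<and> stable j n k"] by auto
  then have "strict_mono s" by (simp add: strict_mono_Suc_iff)
  have step: "g i * p m v \<le> g (Suc i) * p m (v + t *\<^sub>R (y \<circ> s) (Suc i))"
    if "m \<le> j" "j \<le> i" and v: "v \<in> span (e ` {..j} \<union> (y \<circ> s) ` {..i})" for m j i v t
  proof -
    have "span (e ` {..j} \<union> (y \<circ> s) ` {..i}) \<subseteq> V i (s i)"
      unfolding V_def using \<open>j \<le> i\<close> \<open>strict_mono s\<close>
      by (intro span_mono) (auto simp: strict_mono_less_eq)
    moreover have "m \<in> {..i}" using that by simp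
    ultimately show ?thesis using s(2)[of i] v unfolding stable_def o_def by blast
  qed
  have "p m v \<le> 2 * p m (v + r)"
    if "m \<le> j" "v \<in> span (e ` {..j} \<union> (y \<circ> s) ` {..j})" "r \<in> span ((y \<circ> s) ` {j<..})" for m j v r
  proof -
    obtain n where "r \<in> span ((y \<circ> s) ` {j<..n})" using \<open>r \<in> _\<close> by (rule span_image_greaterThan_bounded)
    then have r: "r \<in> span ((y \<circ> s) ` {j<..j + n})" by (rule subsetD[OF span_mono, rotated]) auto
    have "1 * p m v \<le> g j * p m v" by (intro mult_right_mono g equivalent_norm_nonneg p)
    also have "\<dots> \<le> g (j + n) * p m (v + r)"
      by (rule mazur_telescope[OF step that(2) r]) (use that(1) in auto)
    also have "\<dots> \<le> 2 * p m (v + r)" by (intro mult_right_mono g equivalent_norm_nonneg p)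
    finally show ?thesis by simp
  qed
  with \<open>strict_mono s\<close> show thesis by (rule that)
qed

subsection \<open>Basic sequences and copies of the space of null sequences\<close>

definition basic_sequence :: "real \<Rightarrow> (nat \<Rightarrow> 'a::real_normed_vector) \<Rightarrow> bool" where
  "basic_sequence D y \<longleftrightarrow>
     (\<forall>j. \<forall>l\<in>span (y ` {..<j}). \<forall>r\<in>span (y ` {j..}). norm l \<le> D * norm (l + r))"

definition block_sequence :: "(nat \<Rightarrow> 'a::real_vector) \<Rightarrow> (nat \<Rightarrow> nat) \<Rightarrow> (nat \<Rightarrow> 'a) \<Rightarrow> bool" where
  "block_sequence y lo w \<longleftrightarrow> strict_mono lo \<and> (\<forall>j. w j \<in> span (y ` {lo j..<lo (Suc j)}))"

definition upper_c0_estimate :: "real \<Rightarrow> (nat \<Rightarrow> 'a::real_normed_vector) \<Rightarrow> bool" where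
  "upper_c0_estimate B w \<longleftrightarrow> (\<forall>m b. (\<forall>j<m. \<bar>b j\<bar> \<le> 1) \<longrightarrow> norm (\<Sum>j<m. b j *\<^sub>R w j) \<le> B)"

lemma basic_sequence_subseq:
  assumes "basic_sequence D y" "strict_mono s"
  shows "basic_sequence D (y \<circ> s)"
  unfolding basic_sequence_def
proof (intro allI ballI)
  fix j l r assume l: "l \<in> span ((y \<circ> s) ` {..<j})" and r: "r \<in> span ((y \<circ> s) ` {j..})"
  have "(y \<circ> s) ` {..<j} \<subseteq> y ` {..<s j}" "(y \<circ> s) ` {j..} \<subseteq> y ` {s j..}"
    using assms(2) by (auto simp: strict_mono_less strict_mono_less_eq)
  then have "l \<in> span (y ` {..<s j})" "r \<in> span (y ` {s j..})" using l r span_mono by blast+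
  then show "norm l \<le> D * norm (l + r)" using assms(1) unfolding basic_sequence_def by blast
qed

lemma block_sequence_coefficient_le:
  assumes y: "basic_sequence D y" and w: "block_sequence y lo w"
    and a: "\<And>j. a \<le> norm (w j)" and "i < m"
  shows "a * \<bar>b i\<bar> \<le> 2 * D * norm (\<Sum>j<m. b j *\<^sub>R w j)"
proof -
  have lo_mono: "lo p \<le> lo q" if "p \<le> q" for p q
    using w that by (simp add: block_sequence_def strict_mono_less_eq)
  have w_span: "w j \<in> span (y ` A)" if "{lo j..<lo (Suc j)} \<subseteq> A" for j A
    using w span_mono[OF image_mono[OF that]] unfolding block_sequence_def by blast
  have partial: "norm (\<Sum>j<q. b j *\<^sub>R w j) \<le> D * norm (\<Sum>j<m. b j *\<^sub>R w j)" if "q \<le> m" for q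
  proof -
    have "{lo j..<lo (Suc j)} \<subseteq> {..<lo q}" if "j < q" for j using lo_mono[of "Suc j" q] that by auto
    then have "(\<Sum>j<q. b j *\<^sub>R w j) \<in> span (y ` {..<lo q})" by (intro span_sum span_scale w_span) auto
    moreover have "{lo j..<lo (Suc j)} \<subseteq> {lo q..}" if "q \<le> j" for j using lo_mono[OF that] by auto
    then have "(\<Sum>j=q..<m. b j *\<^sub>R w j) \<in> span (y ` {lo q..})" by (intro span_sum span_scale w_span) auto
    ultimately have "norm (\<Sum>j<q. b j *\<^sub>R w j) \<le> D * norm ((\<Sum>j<q. b j *\<^sub>R w j) + (\<Sum>j=q..<m. b j *\<^sub>R w j))"
      using y unfolding basic_sequence_def by blast
    then show ?thesis using that by (simp add: lessThan_atLeast0 sum.atLeastLessThan_concat)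
  qed
  have "a * \<bar>b i\<bar> \<le> norm (b i *\<^sub>R w i)" using a[of i] by (simp add: mult.commute[of a] mult_left_mono)
  also have "\<dots> = norm ((\<Sum>j<Suc i. b j *\<^sub>R w j) - (\<Sum>j<i. b j *\<^sub>R w j))" by simp
  also have "\<dots> \<le> norm (\<Sum>j<Suc i. b j *\<^sub>R w j) + norm (\<Sum>j<i. b j *\<^sub>R w j)" by (rule norm_triangle_ineq4)
  also have "\<dots> \<le> D * norm (\<Sum>j<m. b j *\<^sub>R w j) + D * norm (\<Sum>j<m. b j *\<^sub>R w j)"
    using \<open>i < m\<close> by (intro add_mono partial) auto
  finally show ?thesis by simp
qed

context
  fixes w :: "nat \<Rightarrow> 'a::real_normed_vector" and B :: real
  assumes upper: "upper_c0_estimate B w"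
begin

lemma upper_c0_estimate_nonneg: "0 \<le> B"
  using upper[unfolded upper_c0_estimate_def, rule_format, of 0] by simp

lemma norm_sum_le_upper_c0_estimate:
  assumes b: "\<And>j. j < m \<Longrightarrow> \<bar>b j\<bar> \<le> s" and "0 \<le> s"
  shows "norm (\<Sum>j<m. b j *\<^sub>R w j) \<le> B * s"
proof (cases "s = 0")
  case True
  then show ?thesis using b by simp
next
  case False
  have "norm (\<Sum>j<m. (b j / s) *\<^sub>R w j) \<le> B"
    using b False \<open>0 \<le> s\<close>
    by (intro upper[unfolded upper_c0_estimate_def, rule_format]) (simp add: divide_le_eq)
  moreover have "(\<Sum>j<m. b j *\<^sub>R w j) = s *\<^sub>R (\<Sum>j<m. (b j / s) *\<^sub>R w j)"
    using False by (simp add: scaleR_sum_right)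
  ultimately show ?thesis using \<open>0 \<le> s\<close> by (simp add: mult.commute[of s] mult_right_mono)
qed

end

lemma summable_c0_combination:
  fixes w :: "nat \<Rightarrow> 'a::banach"
  assumes upper: "upper_c0_estimate B w" and x: "x \<in> c0_space"
  shows "summable (\<lambda>j. x j *\<^sub>R w j)"
  unfolding summable_Cauchy
proof (intro allI impI)
  fix r :: real assume "0 < r"
  define s where "s = r / (B + 1)"
  have s: "0 < s" "B * s < r"
    using \<open>0 < r\<close> upper_c0_estimate_nonneg[OF upper] by (simp_all add: s_def field_simps)
  obtain N where N: "\<And>j. N \<le> j \<Longrightarrow> \<bar>x j\<bar> < s"
    using x s(1) unfolding c0_space_def LIMSEQ_iff by fastforce
  have "norm (\<Sum>j=p..<q. x j *\<^sub>R w j) < r" if "N \<le> p" for p q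
  proof -
    have "(\<Sum>j=p..<q. x j *\<^sub>R w j) = (\<Sum>j<q. (if p \<le> j then x j else 0) *\<^sub>R w j)"
      by (rule sum.mono_neutral_cong_left) auto
    also have "norm \<dots> \<le> B * s"
      using N s(1) that by (intro norm_sum_le_upper_c0_estimate[OF upper]) (auto intro: less_imp_le)
    finally show ?thesis using s(2) by simp
  qed
  then show "\<exists>N. \<forall>p\<ge>N. \<forall>q. norm (\<Sum>j=p..<q. x j *\<^sub>R w j) < r" by blast
qed

lemma abs_le_sup_norm:
  assumes "x \<in> c0_space"
  shows "\<bar>x n\<bar> \<le> sup_norm x"
proof -
  have "Bseq x" using assms by (auto simp: c0_space_def intro: convergent_imp_Bseq convergentI)
  then have "bdd_above (range (\<lambda>n. \<bar>x n\<bar>))" by (auto simp: Bseq_def intro: bdd_aboveI2)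
  then show ?thesis unfolding sup_norm_def by (rule cSUP_upper[OF UNIV_I])
qed

lemma contains_c0_if_c0_estimates:
  fixes w :: "nat \<Rightarrow> 'a::banach"
  assumes Z: "subspace Z" "closed Z" "range w \<subseteq> Z" and "0 < A" and upper: "upper_c0_estimate B w"
    and lower: "\<And>m b i. i < m \<Longrightarrow> A * \<bar>b i\<bar> \<le> norm (\<Sum>j<m. b j *\<^sub>R w j)"
  shows "contains_c0 Z"
proof -
  define J where "J x = (\<Sum>j. x j *\<^sub>R w j)" for x
  have lim: "(\<lambda>m. \<Sum>j<m. x j *\<^sub>R w j) \<longlonglongrightarrow> J x" if "x \<in> c0_space" for x
    unfolding J_def using summable_LIMSEQ[OF summable_c0_combination[OF upper that]] .
  have "J (\<lambda>n. a * x n + b * z n) = a *\<^sub>R J x + b *\<^sub>R J z" if "x \<in> c0_space" "z \<in> c0_space" for x z a b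
  proof -
    have "(\<lambda>m. \<Sum>j<m. (a * x j + b * z j) *\<^sub>R w j) \<longlonglongrightarrow> a *\<^sub>R J x + b *\<^sub>R J z"
      using tendsto_add[OF tendsto_scaleR[OF tendsto_const lim[OF that(1)], of a]
          tendsto_scaleR[OF tendsto_const lim[OF that(2)], of b]]
      by (simp add: scaleR_add_left sum.distrib scaleR_sum_right)
    then show ?thesis unfolding J_def by (intro sums_unique[symmetric]) (simp add: sums_def)
  qed
  moreover have "J ` c0_space \<subseteq> Z"
  proof clarify
    fix x assume "x \<in> c0_space"
    have "(\<Sum>j<m. x j *\<^sub>R w j) \<in> Z" for m using Z by (intro subspace_sum subspace_scale) auto
    then show "J x \<in> Z" using closed_sequentially[OF Z(2) _ lim[OF \<open>x \<in> c0_space\<close>]] by blast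
  qed
  moreover have "A * sup_norm x \<le> norm (J x)" if x: "x \<in> c0_space" for x
  proof -
    have "A * \<bar>x n\<bar> \<le> norm (J x)" for n
      by (rule Lim_bounded2[OF tendsto_norm[OF lim[OF x]], of "Suc n"]) (auto intro: lower)
    then have "sup_norm x \<le> norm (J x) / A"
      unfolding sup_norm_def using \<open>0 < A\<close>
      by (intro cSUP_least) (auto simp: pos_le_divide_eq mult.commute)
    then show ?thesis using \<open>0 < A\<close> by (simp add: pos_le_divide_eq mult.commute)
  qed
  moreover have "norm (J x) \<le> (B + 1) * sup_norm x" if x: "x \<in> c0_space" for x
  proof -
    have "0 \<le> sup_norm x" using abs_le_sup_norm[OF x, of 0] by linarith
    then have "norm (J x) \<le> B * sup_norm x"
      by (intro Lim_bounded[OF tendsto_norm[OF lim[OF x]], of 0])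
        (auto intro: norm_sum_le_upper_c0_estimate[OF upper] abs_le_sup_norm[OF x])
    then show ?thesis using \<open>0 \<le> sup_norm x\<close> by (simp add: distrib_right)
  qed
  moreover have "0 < B + 1" using upper_c0_estimate_nonneg[OF upper] by simp
  ultimately show ?thesis unfolding contains_c0_def using \<open>0 < A\<close> by blast
qed

subsection \<open>Combinatorics of the Schreier norm\<close>

definition supported_on :: "'i set \<Rightarrow> ('i \<Rightarrow> 'a::zero) \<Rightarrow> bool" where
  "supported_on A x \<longleftrightarrow> (\<forall>n. x n \<noteq> 0 \<longrightarrow> n \<in> A)"

definition schreier_le :: "(nat \<Rightarrow> real) \<Rightarrow> real \<Rightarrow> bool" where
  "schreier_le x s \<longleftrightarrow> schreier_norm x \<le> ereal s"

lemma supported_on_eq_0: "supported_on A x \<Longrightarrow> n \<notin> A \<Longrightarrow> x n = 0"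
  by (auto simp: supported_on_def)

lemma supported_on_mono: "supported_on A x \<Longrightarrow> A \<subseteq> B \<Longrightarrow> supported_on B x"
  by (auto simp: supported_on_def)

lemma supported_on_mult: "supported_on A x \<Longrightarrow> supported_on A (\<lambda>n. c n * x n)"
  for x :: "'i \<Rightarrow> 'a::mult_zero"
  unfolding supported_on_def by (metis mult_zero_right)

lemma supported_on_add: "supported_on A x \<Longrightarrow> supported_on A y \<Longrightarrow> supported_on A (\<lambda>n. x n + y n)"
  for x :: "'i \<Rightarrow> 'a::monoid_add"
  unfolding supported_on_def by (metis add_0)

lemma supported_on_sum: "(\<And>i. i \<in> I \<Longrightarrow> supported_on A (x i)) \<Longrightarrow> supported_on A (\<lambda>n. \<Sum>i\<in>I. x i n)"
  unfolding supported_on_def by (metis sum.neutral)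

lemma schreier_le_iff:
  "schreier_le x s \<longleftrightarrow> (\<forall>F. schreier_admissible F \<longrightarrow> (\<Sum>k\<in>F. \<bar>x k\<bar>) \<le> s)"
  by (auto simp: schreier_le_def schreier_norm_def SUP_le_iff)

lemma schreier_leI: "(\<And>F. schreier_admissible F \<Longrightarrow> (\<Sum>k\<in>F. \<bar>x k\<bar>) \<le> s) \<Longrightarrow> schreier_le x s"
  by (simp add: schreier_le_iff)

lemma schreier_leD: "schreier_le x s \<Longrightarrow> schreier_admissible F \<Longrightarrow> (\<Sum>k\<in>F. \<bar>x k\<bar>) \<le> s"
  by (simp add: schreier_le_iff)

lemma schreier_admissible_singleton: "schreier_admissible {n}"
  by (simp add: schreier_admissible_def)

lemma abs_le_schreier_le: "schreier_le x s \<Longrightarrow> \<bar>x n\<bar> \<le> s"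
  using schreier_leD[OF _ schreier_admissible_singleton, of x s n] by simp

lemma schreier_le_nonneg: "schreier_le x s \<Longrightarrow> 0 \<le> s"
  using abs_le_schreier_le[of x s 0] by linarith

lemma schreier_le_zero: "0 \<le> s \<Longrightarrow> schreier_le (\<lambda>n. 0) s"
  by (simp add: schreier_le_iff)

lemma schreier_le_dominated:
  assumes "schreier_le x s" "\<And>n. \<bar>y n\<bar> \<le> \<bar>x n\<bar>"
  shows "schreier_le y s"
proof (rule schreier_leI)
  fix F assume "schreier_admissible F"
  then have "(\<Sum>k\<in>F. \<bar>x k\<bar>) \<le> s" using assms(1) schreier_leD by blast
  moreover have "(\<Sum>k\<in>F. \<bar>y k\<bar>) \<le> (\<Sum>k\<in>F. \<bar>x k\<bar>)" by (rule sum_mono) (rule assms(2))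
  ultimately show "(\<Sum>k\<in>F. \<bar>y k\<bar>) \<le> s" by linarith
qed

lemma schreier_le_mono: "schreier_le x s \<Longrightarrow> s \<le> t \<Longrightarrow> schreier_le x t"
  by (force simp: schreier_le_iff)

lemma schreier_le_add:
  assumes "schreier_le x s" "schreier_le y t"
  shows "schreier_le (\<lambda>n. x n + y n) (s + t)"
proof (rule schreier_leI)
  fix F assume F: "schreier_admissible F"
  have "(\<Sum>k\<in>F. \<bar>x k + y k\<bar>) \<le> (\<Sum>k\<in>F. \<bar>x k\<bar> + \<bar>y k\<bar>)" by (rule sum_mono) (rule abs_triangle_ineq)
  also have "\<dots> \<le> s + t"
    using schreier_leD[OF assms(1) F] schreier_leD[OF assms(2) F] by (simp add: sum.distrib)
  finally show "(\<Sum>k\<in>F. \<bar>x k + y k\<bar>) \<le> s + t" .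
qed

lemma schreier_le_cmult:
  assumes "schreier_le x s"
  shows "schreier_le (\<lambda>n. a * x n) (\<bar>a\<bar> * s)"
proof (rule schreier_leI)
  fix F assume F: "schreier_admissible F"
  then show "(\<Sum>k\<in>F. \<bar>a * x k\<bar>) \<le> \<bar>a\<bar> * s"
    using schreier_leD[OF assms F] by (simp add: abs_mult sum_distrib_left[symmetric] mult_left_mono)
qed

lemma schreier_le_weighted:
  assumes "schreier_le x s" "\<And>n. \<bar>c n\<bar> \<le> 1"
  shows "schreier_le (\<lambda>n. c n * x n) s"
  by (rule schreier_le_dominated[OF assms(1)]) (simp add: abs_mult mult_left_le_one_le assms(2))

lemma schreier_le_diff:
  assumes "schreier_le x s" "schreier_le y t"
  shows "schreier_le (\<lambda>n. x n - y n) (s + t)"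
  using schreier_le_add[OF assms(1) schreier_le_cmult[OF assms(2), of "-1"]] by simp

lemma schreier_le_sum:
  assumes "\<And>i. i \<in> I \<Longrightarrow> schreier_le (x i) (s i)"
  shows "schreier_le (\<lambda>n. \<Sum>i\<in>I. x i n) (\<Sum>i\<in>I. s i)"
  using assms
  by (induction I rule: infinite_finite_induct) (auto intro: schreier_le_zero schreier_le_add)

lemma sum_le_if_card_mult_le:
  fixes f :: "'i \<Rightarrow> real"
  assumes "finite F" "card F \<le> k" "0 \<le> \<delta>" "\<And>n. n \<in> F \<Longrightarrow> f n * k \<le> \<delta>"
  shows "(\<Sum>n\<in>F. f n) \<le> \<delta>"
proof (cases "F = {}")
  case False
  then have "0 < k" using assms(1,2) by (metis card_gt_0_iff less_le_trans)
  have "(\<Sum>n\<in>F. f n) \<le> real (card F) * (\<delta> / k)"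
    by (rule sum_bounded_above) (use assms(4) \<open>0 < k\<close> in \<open>simp add: pos_le_divide_eq\<close>)
  also have "\<dots> \<le> real k * (\<delta> / k)"
    using assms(2,3) by (intro mult_right_mono) auto
  finally show ?thesis using \<open>0 < k\<close> by simp
qed (use assms(3) in simp)

text \<open>An admissible set that starts in the block \<open>{k i..<k (Suc i)}\<close> has at most \<open>k (Suc i)\<close>
  elements, so it sees the block \<open>t i\<close> fully but only a negligible part of the later blocks.\<close>

lemma schreier_le_sum_blocks:
  fixes t :: "nat \<Rightarrow> nat \<Rightarrow> real"
  assumes k: "mono k" and supp: "\<And>j. j < m \<Longrightarrow> supported_on {k j..<k (Suc j)} (t j)"
    and R: "\<And>j. j < m \<Longrightarrow> schreier_le (t j) R" "0 \<le> R"
    and small: "\<And>j n. j < m \<Longrightarrow> \<bar>t j n\<bar> * k j \<le> \<delta> j"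
  shows "schreier_le (\<lambda>n. \<Sum>j<m. t j n) (R + (\<Sum>j<m. \<delta> j))"
proof (rule schreier_leI)
  fix F assume F: "schreier_admissible F"
  then have fin: "finite F" and card: "card F \<le> Min F + 1" by (auto simp: schreier_admissible_def)
  define i where "i = (LEAST j. Min F < k (Suc j))"
  have each: "(\<Sum>n\<in>F. \<bar>t j n\<bar>) \<le> (if j = i then R else 0) + \<delta> j" if j: "j < m" for j
  proof -
    have "0 \<le> \<bar>t j 0\<bar> * real (k j)" by simp
    then have \<delta>: "0 \<le> \<delta> j" using small[OF j, of 0] by linarith
    consider "k (Suc j) \<le> Min F" | "j = i" | "Min F < k (Suc j)" "i < j"
      using Least_le[of "\<lambda>j. Min F < k (Suc j)" j] unfolding i_def by fastforce
    then show ?thesis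
    proof cases
      case 1
      have "t j n = 0" if "n \<in> F" for n
        using Min_le[OF fin that] 1 by (intro supported_on_eq_0[OF supp[OF j]]) auto
      then show ?thesis using R(2) \<delta> by simp
    next
      case 2
      then show ?thesis using schreier_leD[OF R(1)[OF j] F] \<delta> by simp
    next
      case 3
      have "Min F < k (Suc i)" using LeastI[of "\<lambda>j. Min F < k (Suc j)" j] 3 unfolding i_def by blast
      also have "k (Suc i) \<le> k j" using k 3(2) by (simp add: monoD)
      finally have "card F \<le> k j" using card by linarith
      then have "(\<Sum>n\<in>F. \<bar>t j n\<bar>) \<le> \<delta> j" using fin \<delta> small[OF j] by (intro sum_le_if_card_mult_le)
      then show ?thesis using 3(2) by simp
    qed
  qed
  have "(\<Sum>n\<in>F. \<bar>\<Sum>j<m. t j n\<bar>) \<le> (\<Sum>n\<in>F. \<Sum>j<m. \<bar>t j n\<bar>)"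
    by (rule sum_mono) (rule sum_abs)
  also have "\<dots> = (\<Sum>j<m. \<Sum>n\<in>F. \<bar>t j n\<bar>)" by (rule sum.swap)
  also have "\<dots> \<le> (\<Sum>j<m. (if j = i then R else 0) + \<delta> j)" by (rule sum_mono) (use each in auto)
  also have "\<dots> \<le> R + (\<Sum>j<m. \<delta> j)" using R(2) by (simp add: sum.distrib sum.delta)
  finally show "(\<Sum>n\<in>F. \<bar>\<Sum>j<m. t j n\<bar>) \<le> R + (\<Sum>j<m. \<delta> j)" .
qed

text \<open>The larger half of a finite set of natural numbers is admissible.\<close>

lemma card_large_coordinates_le:
  assumes x: "schreier_le x s" and \<eta>: "0 < \<eta>" and F: "finite F" "\<And>n. n \<in> F \<Longrightarrow> \<eta> \<le> \<bar>x n\<bar>"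
  shows "card F \<le> 2 * s / \<eta>"
proof (cases "F = {}")
  case True
  then show ?thesis using schreier_le_nonneg[OF x] \<eta> by simp
next
  case False
  define h where "h = card F div 2"
  have "card F \<le> card ({n\<in>F. h \<le> n} \<union> {..<h})" using F(1) by (intro card_mono) auto
  also have "\<dots> \<le> card {n\<in>F. h \<le> n} + h" using card_Un_le[of "{n\<in>F. h \<le> n}" "{..<h}"] by simp
  finally have "card F - h \<le> card {n\<in>F. h \<le> n}" by linarith
  then obtain G where G: "G \<subseteq> {n\<in>F. h \<le> n}" "card G = card F - h" "finite G"
    by (rule obtain_subset_with_card_n)
  have "0 < card F" using False F(1) by (simp add: card_gt_0_iff)
  then have "G \<noteq> {}" using G(2) by (auto simp: h_def)
  then have "h \<le> Min G" using G by auto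
  moreover have half: "card G \<le> h + 1" "card F \<le> 2 * card G" unfolding G(2) h_def by presburger+
  ultimately have "schreier_admissible G"
    unfolding schreier_admissible_def using G(3) \<open>G \<noteq> {}\<close> by linarith
  have "real (card F) \<le> 2 * real (card G)" using half(2) by linarith
  then have "real (card F) * \<eta> \<le> 2 * (real (card G) * \<eta>)" using \<eta> by simp
  also have "real (card G) * \<eta> \<le> (\<Sum>k\<in>G. \<bar>x k\<bar>)"
    using F(2) G(1) by (intro sum_bounded_below) auto
  also have "\<dots> \<le> s" using x \<open>schreier_admissible G\<close> by (rule schreier_leD)
  finally show ?thesis using \<eta> by (simp add: pos_le_divide_eq)
qed

subsection \<open>Small convex combinations of block sequences\<close>

lemma norm_convex_combination_le:
  fixes f :: "'i \<Rightarrow> 'a::real_normed_vector"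
  assumes "finite I" "(\<Sum>i\<in>I. c i) = 1" "\<And>i. i \<in> I \<Longrightarrow> 0 \<le> c i" "\<And>i. i \<in> I \<Longrightarrow> norm (f i) \<le> B"
  shows "norm (\<Sum>i\<in>I. c i *\<^sub>R f i) \<le> B"
  using convex_sum[OF assms(1) convex_cball[of 0 B] assms(2,3), of f] assms(4) by simp

definition average :: "(nat \<Rightarrow> real) \<Rightarrow> nat \<Rightarrow> nat \<Rightarrow> real" where
  "average f a b = (\<Sum>j=a..<b. f j) / real (b - a)"

definition iterated_average_weight :: "(nat \<Rightarrow> nat) \<Rightarrow> nat \<Rightarrow> nat \<Rightarrow> real" where
  "iterated_average_weight a q j =
     (\<Sum>i<q. indicator {a i..<a (Suc i)} j / real (a (Suc i) - a i)) / real q"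

lemma sum_iterated_average_weight:
  assumes "strict_mono a"
  shows "(\<Sum>j<a q. iterated_average_weight a q j * f j) = (\<Sum>i<q. average f (a i) (a (Suc i))) / q"
proof -
  have "average f (a i) (a (Suc i))
      = (\<Sum>j<a q. indicator {a i..<a (Suc i)} j / real (a (Suc i) - a i) * f j)"
    if "i < q" for i
  proof -
    have "{a i..<a (Suc i)} \<subseteq> {..<a q}"
      using that strict_mono_less_eq[OF assms, of "Suc i" q] by auto
    then show ?thesis
      unfolding average_def sum_divide_distrib
      by (intro sum.mono_neutral_cong_left) (auto simp: indicator_def)
  qed
  then have "(\<Sum>i<q. average f (a i) (a (Suc i)))
      = (\<Sum>i<q. \<Sum>j<a q. indicator {a i..<a (Suc i)} j / real (a (Suc i) - a i) * f j)"
    by (intro sum.cong) auto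
  also have "\<dots> = (\<Sum>j<a q. \<Sum>i<q. indicator {a i..<a (Suc i)} j / real (a (Suc i) - a i) * f j)"
    by (rule sum.swap)
  finally show ?thesis
    by (simp add: iterated_average_weight_def sum_divide_distrib sum_distrib_right)
qed

lemma schreier_le_average:
  assumes "\<And>j. j \<in> {a..<b} \<Longrightarrow> schreier_le (t j) R" "0 \<le> R"
  shows "schreier_le (\<lambda>n. average (\<lambda>j. t j n) a b) R"
proof -
  have "schreier_le (\<lambda>n. 1 / real (b - a) * (\<Sum>j=a..<b. t j n)) (\<bar>1 / real (b - a)\<bar> * (\<Sum>j=a..<b. R))"
    by (intro schreier_le_cmult schreier_le_sum assms(1))
  moreover have "\<bar>1 / real (b - a)\<bar> * (\<Sum>j=a..<b. R) \<le> R" using assms(2) by (cases "a < b") simp_all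
  ultimately show ?thesis by (simp add: average_def schreier_le_mono)
qed

lemma supported_on_average:
  fixes k :: "nat \<Rightarrow> nat"
  assumes "mono k" "\<And>j. j \<in> {a..<b} \<Longrightarrow> supported_on {k j..<k (Suc j)} (t j)"
  shows "supported_on {k a..<k b} (\<lambda>n. average (\<lambda>j. t j n) a b)"
proof -
  have "supported_on {k a..<k b} (t j)" if "j \<in> {a..<b}" for j
    using monoD[OF assms(1), of a j] monoD[OF assms(1), of "Suc j" b] that
    by (intro supported_on_mono[OF assms(2)[OF that]]) auto
  then have "supported_on {k a..<k b} (\<lambda>n. \<Sum>j=a..<b. t j n)" by (rule supported_on_sum)
  then show ?thesis by (auto simp: average_def supported_on_def)
qed

lemma abs_average_blocks_le:
  fixes k :: "nat \<Rightarrow> nat"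
  assumes k: "mono k" and supp: "\<And>j. j \<in> {a..<b} \<Longrightarrow> supported_on {k j..<k (Suc j)} (t j)"
    and R: "\<And>j. j \<in> {a..<b} \<Longrightarrow> \<bar>t j n\<bar> \<le> R" "0 \<le> R"
  shows "\<bar>average (\<lambda>j. t j n) a b\<bar> \<le> R / real (b - a)"
proof -
  have "\<bar>\<Sum>j=a..<b. t j n\<bar> \<le> R"
  proof (cases "\<exists>i\<in>{a..<b}. t i n \<noteq> 0")
    case True
    then obtain i where i: "i \<in> {a..<b}" "t i n \<noteq> 0" by blast
    have "t j n = 0" if "j \<in> {a..<b} - {i}" for j
    proof (rule ccontr)
      assume "t j n \<noteq> 0"
      then have "k j \<le> n" "n < k (Suc j)" "k i \<le> n" "n < k (Suc i)"
        using supp[of i] supp[of j] i that by (auto simp: supported_on_def)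
      moreover have "Suc i \<le> j \<or> Suc j \<le> i" using that by auto
      then have "k (Suc i) \<le> k j \<or> k (Suc j) \<le> k i" using k by (auto dest: monoD)
      ultimately show False by linarith
    qed
    then have "(\<Sum>j=a..<b. t j n) = t i n"
      using sum.remove[OF _ i(1), of "\<lambda>j. t j n"] by simp
    then show ?thesis using R(1)[OF i(1)] by simp
  next
    case False
    then show ?thesis using R(2) by (simp add: sum.neutral)
  qed
  then show ?thesis by (simp add: average_def abs_divide divide_right_mono)
qed

text \<open>Each average is so long that its coordinates are negligible against the position where it
  starts.\<close>

lemma schreier_le_iterated_average:
  fixes k a :: "nat \<Rightarrow> nat" and R :: real
  assumes k: "mono k" and a: "strict_mono a" and long: "\<And>i. 2^i * R * k (a i) \<le> real (a (Suc i) - a i)"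
    and supp: "\<And>j. j < a q \<Longrightarrow> supported_on {k j..<k (Suc j)} (t j)"
    and t: "\<And>j. j < a q \<Longrightarrow> schreier_le (t j) R" and R: "0 \<le> R"
  shows "schreier_le (\<lambda>n. (\<Sum>i<q. average (\<lambda>j. t j n) (a i) (a (Suc i))) / q) ((R + 2) / q)"
proof -
  define u where "u i n = average (\<lambda>j. t j n) (a i) (a (Suc i))" for i n
  have "schreier_le (\<lambda>n. \<Sum>i<q. u i n) (R + (\<Sum>i<q. (1/2)^i))"
  proof (rule schreier_le_sum_blocks[where k = "\<lambda>i. k (a i)", OF _ _ _ R])
    show "mono (\<lambda>i. k (a i))" using strict_mono_mono[OF a] k by (simp add: mono_def)
    fix i assume "i < q"
    then have less: "j < a q" if "j \<in> {a i..<a (Suc i)}" for j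
      using that strict_mono_less_eq[OF a, of "Suc i" q] by auto
    show "supported_on {k (a i)..<k (a (Suc i))} (u i)"
      unfolding u_def by (intro supported_on_average k supp less)
    show "schreier_le (u i) R"
      unfolding u_def by (intro schreier_le_average t less R)
    fix n
    have "\<bar>u i n\<bar> * k (a i) \<le> R / real (a (Suc i) - a i) * k (a i)"
      unfolding u_def
      by (intro mult_right_mono abs_average_blocks_le[OF k] supp abs_le_schreier_le[OF t] less R) auto
    also have "\<dots> \<le> (1/2)^i"
      using long[of i] strict_monoD[OF a, of i "Suc i"] by (simp add: field_simps power_divide)
    finally show "\<bar>u i n\<bar> * k (a i) \<le> (1/2)^i" .
  qed
  then have "schreier_le (\<lambda>n. \<Sum>i<q. u i n) (R + 2)"
    by (rule schreier_le_mono) (simp add: sum_gp_strict)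
  from schreier_le_cmult[OF this, of "1 / q"] show ?thesis by (simp add: u_def)
qed

lemma schreier_convex_weights:
  fixes k :: "nat \<Rightarrow> nat" and R \<epsilon> :: real
  assumes k: "mono k" and R: "0 \<le> R" and \<epsilon>: "0 < \<epsilon>"
  obtains m :: nat and c :: "nat \<Rightarrow> real" where "\<And>j. 0 \<le> c j" "(\<Sum>j<m. c j) = 1"
    "\<And>t. (\<And>j. j < m \<Longrightarrow> supported_on {k j..<k (Suc j)} (t j)) \<Longrightarrow>
      (\<And>j. j < m \<Longrightarrow> schreier_le (t j) R) \<Longrightarrow> schreier_le (\<lambda>n. \<Sum>j<m. c j * t j n) \<epsilon>"
proof -
  have "\<exists>b. a < b \<and> 2^i * R * k a \<le> real (b - a)" for a i
  proof -
    obtain l :: nat where "2^i * R * k a \<le> l" using real_arch_simple by blast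
    then show ?thesis by (intro exI[of _ "a + Suc l"]) simp
  qed
  then obtain a where a_less: "\<And>i. a i < a (Suc i)"
    and long: "\<And>i. 2^i * R * k (a i) \<le> real (a (Suc i) - a i)"
    using dependent_nat_choice[of "\<lambda>_ _. True" "\<lambda>i a b. a < b \<and> 2^i * R * k a \<le> real (b - a)"] by auto
  then have a: "strict_mono a" by (simp add: strict_mono_Suc_iff)
  obtain q :: nat where q: "(R + 2) / \<epsilon> < q" using reals_Archimedean2 by blast
  have "0 < (R + 2) / \<epsilon>" using R \<epsilon> by simp
  then have q_pos: "0 < real q" using q by linarith
  let ?c = "iterated_average_weight a q"
  show thesis
  proof (rule that[of ?c "a q"])
    show "0 \<le> ?c j" for j by (simp add: iterated_average_weight_def sum_nonneg)
    have "average (\<lambda>_. 1) (a i) (a (Suc i)) = 1" for i using a_less[of i] by (simp add: average_def)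
    then show "(\<Sum>j<a q. ?c j) = 1" using sum_iterated_average_weight[OF a, of q "\<lambda>_. 1"] q_pos by simp
  next
    fix t :: "nat \<Rightarrow> nat \<Rightarrow> real"
    assume supp: "\<And>j. j < a q \<Longrightarrow> supported_on {k j..<k (Suc j)} (t j)"
      and t: "\<And>j. j < a q \<Longrightarrow> schreier_le (t j) R"
    have "(R + 2) / q \<le> \<epsilon>" using q \<epsilon> q_pos by (simp add: field_simps)
    with schreier_le_iterated_average[OF k a long supp t R]
    have "schreier_le (\<lambda>n. (\<Sum>i<q. average (\<lambda>j. t j n) (a i) (a (Suc i))) / q) \<epsilon>"
      by (rule schreier_le_mono)
    then show "schreier_le (\<lambda>n. \<Sum>j<a q. ?c j * t j n) \<epsilon>"
      by (simp only: sum_iterated_average_weight[OF a])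
  qed
qed

subsection \<open>Almost open maps on the finitely supported sequences\<close>

lemma finitely_supported_iff: "finitely_supported x \<longleftrightarrow> (\<exists>M. supported_on {..<M} x)"
  by (auto simp: finitely_supported_def supported_on_def finite_nat_iff_bounded)

lemma finitely_supported_if_supported_on: "finite A \<Longrightarrow> supported_on A x \<Longrightarrow> finitely_supported x"
  unfolding finitely_supported_def supported_on_def by (rule finite_subset[of _ A]) auto

lemma finitely_supported_zero [simp]: "finitely_supported (\<lambda>n. 0)"
  by (simp add: finitely_supported_def)

lemma finitely_supported_mult [simp]: "finitely_supported x \<Longrightarrow> finitely_supported (\<lambda>n. c n * x n)"
  unfolding finitely_supported_def by (rule finite_subset[of _ "{n. x n \<noteq> 0}"]) auto

lemma finitely_supported_add [simp]:
  "finitely_supported x \<Longrightarrow> finitely_supported y \<Longrightarrow> finitely_supported (\<lambda>n. x n + y n)"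
  unfolding finitely_supported_def by (rule finite_subset[of _ "{n. x n \<noteq> 0} \<union> {n. y n \<noteq> 0}"]) auto

lemma finitely_supported_diff [simp]:
  "finitely_supported x \<Longrightarrow> finitely_supported y \<Longrightarrow> finitely_supported (\<lambda>n. x n - y n)"
  unfolding finitely_supported_def by (rule finite_subset[of _ "{n. x n \<noteq> 0} \<union> {n. y n \<noteq> 0}"]) auto

lemma finitely_supported_sum [simp]:
  "(\<And>i. i \<in> I \<Longrightarrow> finitely_supported (x i)) \<Longrightarrow> finitely_supported (\<lambda>n. \<Sum>i\<in>I. x i n)"
  by (induction I rule: infinite_finite_induct) auto

lemma schreier_le_if_finitely_supported:
  assumes "finitely_supported x"
  obtains s where "schreier_le x s"
proof -
  have "schreier_le x (\<Sum>n | x n \<noteq> 0. \<bar>x n\<bar>)"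
  proof (rule schreier_leI)
    fix F assume "schreier_admissible F"
    then have "finite F" by (simp add: schreier_admissible_def)
    then have "(\<Sum>n\<in>F. \<bar>x n\<bar>) = (\<Sum>n\<in>F \<inter> {n. x n \<noteq> 0}. \<bar>x n\<bar>)"
      by (intro sum.mono_neutral_right) auto
    also have "\<dots> \<le> (\<Sum>n | x n \<noteq> 0. \<bar>x n\<bar>)"
      using assms by (intro sum_mono2) (auto simp: finitely_supported_def)
    finally show "(\<Sum>n\<in>F. \<bar>x n\<bar>) \<le> (\<Sum>n | x n \<noteq> 0. \<bar>x n\<bar>)" .
  qed
  then show thesis by (rule that)
qed

lemma schreier_space_approximation:
  assumes "x \<in> schreier_space" "0 < \<epsilon>"
  obtains z where "finitely_supported z" "schreier_le (\<lambda>n. x n - z n) \<epsilon>"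
proof -
  obtain z where "finitely_supported z" "schreier_norm (\<lambda>n. x n - z n) < ereal \<epsilon>"
    using assms unfolding schreier_space_def by blast
  then show thesis using that by (simp add: schreier_le_def less_imp_le)
qed

lemma finitely_supported_in_schreier_space:
  assumes "finitely_supported x"
  shows "x \<in> schreier_space"
  unfolding schreier_space_def
proof (intro CollectI allI impI exI conjI)
  fix \<epsilon> :: real assume "0 < \<epsilon>"
  have "schreier_norm (\<lambda>n. x n - x n) \<le> ereal 0"
    using schreier_le_zero[of 0] by (simp add: schreier_le_def)
  also have "\<dots> < ereal \<epsilon>" using \<open>0 < \<epsilon>\<close> by simp
  finally show "schreier_norm (\<lambda>n. x n - x n) < ereal \<epsilon>" .
qed (rule assms)

lemma schreier_space_diff_finitely_supported:
  assumes x: "x \<in> schreier_space" and z: "finitely_supported z"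
  shows "(\<lambda>n. x n - z n) \<in> schreier_space"
  unfolding schreier_space_def
proof (intro CollectI allI impI)
  fix \<epsilon> :: real assume "0 < \<epsilon>"
  then obtain z' where "finitely_supported z'" "schreier_norm (\<lambda>n. x n - z' n) < ereal \<epsilon>"
    using x unfolding schreier_space_def by blast
  then show "\<exists>y. finitely_supported y \<and> schreier_norm (\<lambda>n. x n - z n - y n) < ereal \<epsilon>"
    using z by (intro exI[of _ "\<lambda>n. z' n - z n"]) simp
qed

locale c00_linear =
  fixes T :: "(nat \<Rightarrow> real) \<Rightarrow> 'a::real_normed_vector"
  assumes T_lincomb: "finitely_supported x \<Longrightarrow> finitely_supported z \<Longrightarrow>
      T (\<lambda>n. a * x n + b * z n) = a *\<^sub>R T x + b *\<^sub>R T z"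
begin

lemma T_add: "finitely_supported x \<Longrightarrow> finitely_supported z \<Longrightarrow> T (\<lambda>n. x n + z n) = T x + T z"
  using T_lincomb[of x z 1 1] by simp

lemma T_diff: "finitely_supported x \<Longrightarrow> finitely_supported z \<Longrightarrow> T (\<lambda>n. x n - z n) = T x - T z"
  using T_lincomb[of x z 1 "-1"] by simp

lemma T_cmult: "finitely_supported x \<Longrightarrow> T (\<lambda>n. a * x n) = a *\<^sub>R T x"
  using T_lincomb[of x x a 0] by simp

lemma T_zero: "T (\<lambda>n. 0) = 0"
  using T_cmult[of "\<lambda>n. 0" 0] by simp

lemma T_sum:
  assumes "\<And>i. i \<in> I \<Longrightarrow> finitely_supported (x i)"
  shows "T (\<lambda>n. \<Sum>i\<in>I. c i * x i n) = (\<Sum>i\<in>I. c i *\<^sub>R T (x i))"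
  using assms
proof (induction I rule: infinite_finite_induct)
  case (insert i I)
  then have "T (\<lambda>n. c i * x i n + (\<Sum>i\<in>I. c i * x i n)) = c i *\<^sub>R T (x i) + T (\<lambda>n. \<Sum>i\<in>I. c i * x i n)"
    by (subst T_add) (auto simp: T_cmult)
  then show ?case using insert by simp
qed (simp_all add: T_zero)

lemma T_split:
  assumes "finitely_supported x"
  shows "T x = T (\<lambda>n. indicator {..<k} n * x n) + T (\<lambda>n. indicator {k..} n * x n)"
proof -
  have "(\<lambda>n. indicator {..<k} n * x n + indicator {k..} n * x n) = x" by (auto simp: indicator_def)
  then show ?thesis using assms by (metis T_add finitely_supported_mult)
qed

abbreviation unit_image :: "nat \<Rightarrow> 'a" where
  "unit_image n \<equiv> T (indicator {n})"

lemma T_in_span: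
  assumes "supported_on {..<M} x"
  shows "T x \<in> span (unit_image ` {..<M})"
proof -
  have "(\<lambda>n. \<Sum>i<M. x i * indicator {i} n) = x"
  proof
    fix n show "(\<Sum>i<M. x i * indicator {i} n) = x n"
      using supported_on_eq_0[OF assms, of n]
      by (cases "n < M") (auto simp: indicator_def if_distrib cong: if_cong)
  qed
  moreover have "T (\<lambda>n. \<Sum>i<M. x i * indicator {i} n) = (\<Sum>i<M. x i *\<^sub>R unit_image i)"
    by (intro T_sum finitely_supported_if_supported_on[of "{_}"])
      (auto simp: supported_on_def indicator_def)
  ultimately have "T x = (\<Sum>i<M. x i *\<^sub>R unit_image i)" by simp
  moreover have "(\<Sum>i<M. x i *\<^sub>R unit_image i) \<in> span (unit_image ` {..<M})"
    by (intro span_sum span_scale span_base) auto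
  ultimately show ?thesis by simp
qed

lemma sublinear_cost_image:
  "sublinear_cost (\<lambda>y s. \<exists>x. finitely_supported x \<and> schreier_le x s \<and> T x = y)"
proof
  fix y z s t
  assume "\<exists>x. finitely_supported x \<and> schreier_le x s \<and> T x = y"
    and "\<exists>x. finitely_supported x \<and> schreier_le x t \<and> T x = z"
  then show "\<exists>x. finitely_supported x \<and> schreier_le x (s + t) \<and> T x = y + z"
    by (metis T_add finitely_supported_add schreier_le_add)
next
  fix y s a
  assume "\<exists>x. finitely_supported x \<and> schreier_le x s \<and> T x = y"
  then obtain x where "finitely_supported x" "schreier_le x s" "T x = y" by blast
  then show "\<exists>x. finitely_supported x \<and> schreier_le x (\<bar>a\<bar> * s) \<and> T x = a *\<^sub>R y"
    by (intro exI[of _ "\<lambda>n. a * x n"]) (simp add: T_cmult schreier_le_cmult)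
qed (auto dest: schreier_le_nonneg)

end

locale schreier_quotient = c00_linear T for T :: "(nat \<Rightarrow> real) \<Rightarrow> 'a::banach" +
  fixes C K :: real
  assumes C_pos: "0 < C" and K_pos: "0 < K"
    and T_bound: "finitely_supported x \<Longrightarrow> schreier_le x s \<Longrightarrow> norm (T x) \<le> C * s"
    and approximate_lift: "0 < \<epsilon> \<Longrightarrow>
      \<exists>x. finitely_supported x \<and> schreier_le x (K * norm y) \<and> norm (y - T x) < \<epsilon>"

context
  fixes T :: "(nat \<Rightarrow> real) \<Rightarrow> 'a::real_normed_vector"
  assumes T: "quotient_of_schreier T"
begin

lemma quotient_of_schreier_lincomb:
  "x \<in> schreier_space \<Longrightarrow> z \<in> schreier_space \<Longrightarrow> T (\<lambda>n. a * x n + b * z n) = a *\<^sub>R T x + b *\<^sub>R T z"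
  using T by (simp add: quotient_of_schreier_def)

lemma quotient_of_schreier_bound:
  obtains C where "0 < C" "\<And>x s. x \<in> schreier_space \<Longrightarrow> schreier_le x s \<Longrightarrow> norm (T x) \<le> C * s"
proof -
  obtain C where C: "\<And>x. x \<in> schreier_space \<Longrightarrow> ereal (norm (T x)) \<le> ereal C * schreier_norm x"
    using T unfolding quotient_of_schreier_def by blast
  have "norm (T x) \<le> (\<bar>C\<bar> + 1) * s" if "x \<in> schreier_space" "schreier_le x s" for x s
  proof -
    have "0 \<le> schreier_norm x"
      unfolding schreier_norm_def
      by (rule SUP_upper2[of "{0}"]) (auto simp: schreier_admissible_singleton)
    have "ereal (norm (T x)) \<le> ereal C * schreier_norm x" using that(1) by (rule C)
    also have "\<dots> \<le> ereal (\<bar>C\<bar> + 1) * schreier_norm x"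
      using \<open>0 \<le> schreier_norm x\<close> by (intro ereal_mult_right_mono) simp_all
    also have "\<dots> \<le> ereal (\<bar>C\<bar> + 1) * ereal s"
      using that(2) by (intro ereal_mult_left_mono) (auto simp: schreier_le_def)
    finally show ?thesis by simp
  qed
  then show thesis by (intro that[of "\<bar>C\<bar> + 1"]) auto
qed

lemma in_closure_image_finitely_supported:
  obtains N where "y \<in> closure {z. \<exists>x. finitely_supported x \<and> schreier_le x (real N) \<and> T x = z}"
proof -
  obtain C where C: "0 < C" "\<And>x s. x \<in> schreier_space \<Longrightarrow> schreier_le x s \<Longrightarrow> norm (T x) \<le> C * s"
    using quotient_of_schreier_bound by blast
  obtain x where x: "x \<in> schreier_space" "y = T x"
    using T unfolding quotient_of_schreier_def by (metis UNIV_I imageE)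
  obtain z0 where z0: "finitely_supported z0" "schreier_le (\<lambda>n. x n - z0 n) 1"
    by (rule schreier_space_approximation[OF x(1) zero_less_one])
  obtain s where "schreier_le z0 s" using z0(1) by (rule schreier_le_if_finitely_supported)
  from schreier_le_add[OF z0(2) this] have x_le: "schreier_le x (1 + s)" by simp
  obtain N :: nat where N: "1 + s + 1 \<le> real N" using real_arch_simple by blast
  have "\<exists>v\<in>{z. \<exists>x. finitely_supported x \<and> schreier_le x (real N) \<and> T x = z}. dist v y < r"
    if "0 < r" for r
  proof -
    define \<epsilon> where "\<epsilon> = min 1 (r / (2 * C))"
    have \<epsilon>: "0 < \<epsilon>" "\<epsilon> \<le> 1" "C * \<epsilon> < r"
      using that C(1) by (auto simp: \<epsilon>_def min_def field_simps)
    obtain z where z: "finitely_supported z" "schreier_le (\<lambda>n. x n - z n) \<epsilon>"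
      by (rule schreier_space_approximation[OF x(1) \<epsilon>(1)])
    have "schreier_le z (1 + s + \<epsilon>)" using schreier_le_diff[OF x_le z(2)] by simp
    then have "schreier_le z N" by (rule schreier_le_mono) (use N \<epsilon>(2) in linarith)
    have "norm (T (\<lambda>n. x n - z n)) \<le> C * \<epsilon>"
      by (intro C(2) schreier_space_diff_finitely_supported x(1) z)
    moreover have "T (\<lambda>n. x n - z n) = y - T z"
      using quotient_of_schreier_lincomb[OF x(1) finitely_supported_in_schreier_space[OF z(1)], of 1 "-1"]
        x(2)
      by simp
    ultimately have "dist (T z) y < r" using \<epsilon>(3) by (simp add: dist_norm norm_minus_commute)
    then show ?thesis using z(1) \<open>schreier_le z N\<close> by blast
  qed
  then show thesis by (intro that[of N]) (simp add: closure_approachable)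
qed

end

lemma schreier_quotient_if_quotient_of_schreier:
  fixes T :: "(nat \<Rightarrow> real) \<Rightarrow> 'a::banach"
  assumes T: "quotient_of_schreier T"
  obtains C K where "schreier_quotient T C K"
proof -
  let ?cost = "\<lambda>y s. \<exists>x. finitely_supported x \<and> schreier_le x s \<and> T x = y"
  interpret c00_linear T
    by unfold_locales (intro quotient_of_schreier_lincomb T finitely_supported_in_schreier_space)
  obtain C where C: "0 < C" "\<And>x s. x \<in> schreier_space \<Longrightarrow> schreier_le x s \<Longrightarrow> norm (T x) \<le> C * s"
    using quotient_of_schreier_bound[OF T] by blast
  have "\<exists>N. y \<in> closure {z. ?cost z (real N)}" for y
    using in_closure_image_finitely_supported[OF T] by blast
  then obtain K where K: "0 \<le> K" "\<And>y. y \<in> closure {z. ?cost z (K * norm y)}"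
    using sublinear_cost_approximate_preimages[OF sublinear_cost_image] by blast
  have "schreier_quotient T C (K + 1)"
  proof
    fix \<epsilon> :: real and y :: 'a assume "0 < \<epsilon>"
    then obtain x where x: "finitely_supported x" "schreier_le x (K * norm y)" "norm (y - T x) < \<epsilon>"
      using K(2)[of y] unfolding closure_approachable by (auto simp: dist_norm norm_minus_commute)
    have "schreier_le x ((K + 1) * norm y)"
      using x(2) by (rule schreier_le_mono) (simp add: distrib_right)
    with x show "\<exists>x. finitely_supported x \<and> schreier_le x ((K + 1) * norm y) \<and> norm (y - T x) < \<epsilon>"
      by blast
  qed (use C K(1) finitely_supported_in_schreier_space in auto)
  then show thesis by (rule that)
qed

subsection \<open>Tail gauges\<close>

context schreier_quotient
begin

definition tail_cost :: "nat \<Rightarrow> 'a \<Rightarrow> real \<Rightarrow> bool" where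
  "tail_cost m y c \<longleftrightarrow> (\<exists>x s. finitely_supported x \<and> supported_on {m..} x \<and> schreier_le x s \<and>
     s + (real m + 1) * norm (y - T x) \<le> c)"

text \<open>The gauge of \<open>T (ball of the vectors supported in {m..}) + ball / (m + 1)\<close>, up to a
  factor \<open>2\<close>. Each \<open>tail_gauge m\<close> is an equivalent norm, but on a fixed nonzero vector they tend to
  infinity because bounded block sequences have convex combinations tending to \<open>0\<close>.\<close>

definition tail_gauge :: "nat \<Rightarrow> 'a \<Rightarrow> real" where
  "tail_gauge m = cost_gauge (tail_cost m)"

lemma sublinear_tail_cost: "sublinear_cost (tail_cost m)"
proof
  fix y c assume "tail_cost m y c"
  then obtain x s where "schreier_le x s" "s + (real m + 1) * norm (y - T x) \<le> c"
    unfolding tail_cost_def by blast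
  then show "0 \<le> c" using schreier_le_nonneg[of x s] by (auto elim!: order_trans[rotated])
next
  fix y c z d assume "tail_cost m y c" "tail_cost m z d"
  then obtain x s x' s' where x: "finitely_supported x" "supported_on {m..} x" "schreier_le x s"
      "s + (real m + 1) * norm (y - T x) \<le> c"
    and x': "finitely_supported x'" "supported_on {m..} x'" "schreier_le x' s'"
      "s' + (real m + 1) * norm (z - T x') \<le> d"
    unfolding tail_cost_def by blast
  have "norm (y + z - T (\<lambda>n. x n + x' n)) \<le> norm (y - T x) + norm (z - T x')"
    unfolding T_add[OF x(1) x'(1)] by (rule norm_diff_triangle_ineq)
  then have "(real m + 1) * norm (y + z - T (\<lambda>n. x n + x' n))
      \<le> (real m + 1) * (norm (y - T x) + norm (z - T x'))"
    by (rule mult_left_mono) simp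
  then have "s + s' + (real m + 1) * norm (y + z - T (\<lambda>n. x n + x' n)) \<le> c + d"
    using x(4) x'(4) by (simp only: distrib_left)
  moreover have "supported_on {m..} (\<lambda>n. x n + x' n)" using x(2) x'(2) by (rule supported_on_add)
  ultimately show "tail_cost m (y + z) (c + d)"
    unfolding tail_cost_def using x(1,3) x'(1,3) finitely_supported_add schreier_le_add by blast
next
  fix y c a assume "tail_cost m y c"
  then obtain x s where x: "finitely_supported x" "supported_on {m..} x" "schreier_le x s"
    "s + (real m + 1) * norm (y - T x) \<le> c"
    unfolding tail_cost_def by blast
  have "\<bar>a\<bar> * s + (real m + 1) * norm (a *\<^sub>R y - T (\<lambda>n. a * x n))
      = \<bar>a\<bar> * (s + (real m + 1) * norm (y - T x))"
    unfolding T_cmult[OF x(1)] scaleR_diff_right[symmetric] norm_scaleR by (simp add: algebra_simps)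
  also have "\<dots> \<le> \<bar>a\<bar> * c" using x(4) by (rule mult_left_mono) simp
  finally show "tail_cost m (a *\<^sub>R y) (\<bar>a\<bar> * c)"
    unfolding tail_cost_def using x
    by (intro exI[of _ "\<lambda>n. a * x n"] exI[of _ "\<bar>a\<bar> * s"])
      (simp add: supported_on_mult schreier_le_cmult)
qed

lemma tail_gauge_le:
  assumes "finitely_supported x" "supported_on {m..} x" "schreier_le x s"
  shows "tail_gauge m y \<le> s + (real m + 1) * norm (y - T x)"
  unfolding tail_gauge_def
  using assms by (intro sublinear_cost.cost_gauge_le[OF sublinear_tail_cost]) (auto simp: tail_cost_def)

lemma tail_gauge_le_norm: "tail_gauge m y \<le> (real m + 1) * norm y"
  using tail_gauge_le[of "\<lambda>_. 0" m 0 y]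
  by (simp add: schreier_le_zero T_zero supported_on_def)

lemma tail_cost_total: "\<exists>c. tail_cost m y c"
  unfolding tail_cost_def using schreier_le_zero[of 0]
  by (intro exI[of _ "\<lambda>_. 0"] exI[of _ 0] exI conjI order_refl) (auto simp: supported_on_def)

lemma tail_gauge_lessE:
  assumes "tail_gauge m y < t"
  obtains x where "finitely_supported x" "supported_on {m..} x" "schreier_le x t"
    "(real m + 1) * norm (y - T x) < t"
proof -
  obtain x s where x: "finitely_supported x" "supported_on {m..} x" "schreier_le x s"
    "s + (real m + 1) * norm (y - T x) < t"
    using assms unfolding tail_gauge_def
      sublinear_cost.cost_gauge_less_iff[OF sublinear_tail_cost tail_cost_total]
    by (auto simp: tail_cost_def intro: le_less_trans)
  have "0 \<le> (real m + 1) * norm (y - T x)" by simp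
  then have "s \<le> t" using x(4) by linarith
  then have "schreier_le x t" by (rule schreier_le_mono[OF x(3)])
  moreover have "(real m + 1) * norm (y - T x) < t" using x(4) schreier_le_nonneg[OF x(3)] by linarith
  ultimately show thesis using x(1,2) by (intro that)
qed

lemma norm_le_tail_gauge: "norm y \<le> (C + 1) * tail_gauge m y"
proof -
  have "norm y / (C + 1) \<le> t" if t: "tail_gauge m y < t" for t
  proof -
    obtain x where x: "finitely_supported x" "schreier_le x t" "(real m + 1) * norm (y - T x) < t"
      using t by (rule tail_gauge_lessE)
    have "1 * norm (y - T x) \<le> (real m + 1) * norm (y - T x)" by (rule mult_right_mono) auto
    then have "norm (y - T x) \<le> t" using x(3) by simp
    moreover have "norm y \<le> norm (T x) + norm (y - T x)"
      using norm_triangle_ineq[of "T x" "y - T x"] by simp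
    ultimately have "norm y \<le> t * (C + 1)" using T_bound[OF x(1,2)] by (simp add: algebra_simps)
    then show ?thesis using C_pos by (simp add: pos_divide_le_eq)
  qed
  then have "norm y / (C + 1) \<le> tail_gauge m y" by (rule dense_ge)
  then show ?thesis using C_pos by (simp add: pos_divide_le_eq mult.commute)
qed

lemma equivalent_norm_tail_gauge: "equivalent_norm (tail_gauge m)"
  unfolding equivalent_norm_def
proof (intro conjI allI)
  interpret sublinear_cost "tail_cost m" by (rule sublinear_tail_cost)
  show "tail_gauge m (x + y) \<le> tail_gauge m x + tail_gauge m y" for x y
    unfolding tail_gauge_def by (intro cost_gauge_add tail_cost_total)
  show "tail_gauge m (a *\<^sub>R x) = \<bar>a\<bar> * tail_gauge m x" for a x
    unfolding tail_gauge_def by (intro cost_gauge_scaleR tail_cost_total)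
  show "\<exists>A>0. \<forall>x. A * norm x \<le> tail_gauge m x"
    using norm_le_tail_gauge C_pos
    by (intro exI[of _ "1 / (C + 1)"]) (auto simp: pos_divide_le_eq mult.commute)
  show "\<exists>B. \<forall>x. tail_gauge m x \<le> B * norm x" using tail_gauge_le_norm by blast
qed

end

subsection \<open>Sequences with successive lifts\<close>

locale lifted_sequence = schreier_quotient T C K
  for T :: "(nat \<Rightarrow> real) \<Rightarrow> 'a::banach" and C K +
  fixes y :: "nat \<Rightarrow> 'a" and u :: "nat \<Rightarrow> nat \<Rightarrow> real"
  assumes y_ge: "1/2 \<le> norm (y j)" and y_le: "norm (y j) \<le> 2"
    and u_finite: "finitely_supported (u j)" and u_le: "schreier_le (u j) (2 * K)"
    and u_err: "norm (y j - T (u j)) \<le> (1/2)^j"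

locale schreier_blocks = lifted_sequence T C K y u
  for T :: "(nat \<Rightarrow> real) \<Rightarrow> 'a::banach" and C K y u +
  fixes pos :: "nat \<Rightarrow> nat"
  assumes pos: "strict_mono pos" and u_supp: "supported_on {pos j..<pos (Suc j)} (u j)"

context schreier_quotient
begin

lemma lifts_with_close_heads:
  assumes "\<And>n. finitely_supported (x n)" "\<And>n::nat. schreier_le (x n) s" "0 < \<epsilon>"
  obtains p q where "p \<noteq> q" "norm (T (\<lambda>n. indicator {..<N} n * (x p n - x q n))) < \<epsilon>"
proof -
  define f where "f p = T (\<lambda>n. indicator {..<N} n * x p n)" for p
  have "f p \<in> span (unit_image ` {..<N}) \<inter> cball 0 (C * s)" for p
  proof -
    have "f p \<in> span (unit_image ` {..<N})"
      unfolding f_def by (rule T_in_span) (simp add: supported_on_def indicator_def)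
    moreover have "norm (f p) \<le> C * s"
      unfolding f_def
      by (intro T_bound schreier_le_weighted finitely_supported_mult assms) (simp add: indicator_def)
    ultimately show ?thesis by simp
  qed
  then have "range f \<subseteq> span (unit_image ` {..<N}) \<inter> cball 0 (C * s)" by blast
  moreover have "compact (span (unit_image ` {..<N}) \<inter> cball 0 (C * s))"
    by (intro compact_span_cball) simp
  ultimately obtain p q where "p \<noteq> q" "dist (f p) (f q) < \<epsilon>"
    using \<open>0 < \<epsilon>\<close> by (metis compact_sequence_close_terms)
  moreover have "f p - f q = T (\<lambda>n. indicator {..<N} n * (x p n - x q n))"
    unfolding f_def right_diff_distrib by (intro T_diff[symmetric] finitely_supported_mult assms)
  ultimately show thesis by (intro that) (auto simp: dist_norm)
qed

lemma tail_lifted_vector: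
  assumes Z: "subspace Z" "infinite_dimensional Z" and "0 < \<epsilon>"
  obtains y u M where "y \<in> Z" "1/2 \<le> norm y" "norm y \<le> 2" "N < M"
    "schreier_le u (2 * K)" "supported_on {N..<M} u" "norm (y - T u) \<le> \<epsilon>"
proof -
  obtain z :: "nat \<Rightarrow> 'a" where z: "\<And>n. z n \<in> Z" "\<And>n. norm (z n) = 1"
    "\<And>m n. m \<noteq> n \<Longrightarrow> 1/2 \<le> norm (z m - z n)"
    by (rule infinite_dimensional_separated_sequence[OF Z, of "1/2"]) auto
  have "\<exists>x. finitely_supported x \<and> schreier_le x K \<and> norm (z n - T x) < \<epsilon> / 3" for n
    using approximate_lift[of "\<epsilon> / 3" "z n"] \<open>0 < \<epsilon>\<close> z(2)[of n] by simp
  then obtain x where x: "\<And>n. finitely_supported (x n)" "\<And>n. schreier_le (x n) K"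
    "\<And>n. norm (z n - T (x n)) < \<epsilon> / 3"
    by metis
  obtain p q where pq: "p \<noteq> q" "norm (T (\<lambda>n. indicator {..<N} n * (x p n - x q n))) < \<epsilon> / 3"
    by (rule lifts_with_close_heads[of x K "\<epsilon> / 3" N]) (use x \<open>0 < \<epsilon>\<close> in auto)
  define d where "d n = x p n - x q n" for n
  define u where "u n = indicator {N..} n * d n" for n
  have d: "finitely_supported d" "schreier_le d (2 * K)"
    using x(1) schreier_le_diff[OF x(2)[of p] x(2)[of q]] unfolding d_def[abs_def] by simp_all
  have "T d = T (x p) - T (x q)" unfolding d_def[abs_def] using x(1) by (intro T_diff)
  moreover have "T d = T (\<lambda>n. indicator {..<N} n * d n) + T u"
    unfolding u_def[abs_def] using d(1) by (rule T_split)
  ultimately have "z p - z q - T u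
      = (z p - T (x p)) - (z q - T (x q)) + T (\<lambda>n. indicator {..<N} n * d n)"
    by (simp add: algebra_simps)
  also have "norm \<dots>
      \<le> norm (z p - T (x p)) + norm (z q - T (x q)) + norm (T (\<lambda>n. indicator {..<N} n * d n))"
    by (intro norm_triangle_le add_right_mono norm_triangle_ineq4)
  also have "\<dots> \<le> \<epsilon>" using x(3)[of p] x(3)[of q] pq(2) by (simp add: d_def)
  finally have err: "norm (z p - z q - T u) \<le> \<epsilon>" .
  obtain M where "supported_on {..<M} d" using d(1) finitely_supported_iff by blast
  then have "supported_on {N..<max M (Suc N)} u"
    by (fastforce simp: supported_on_def u_def indicator_def split: if_splits)
  moreover have "schreier_le u (2 * K)"
    unfolding u_def[abs_def] using d(2) by (rule schreier_le_weighted) (simp add: indicator_def)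
  moreover have "norm (z p - z q) \<le> 2" using norm_triangle_ineq4[of "z p" "z q"] z(2) by simp
  moreover have "z p - z q \<in> Z" using Z(1) z(1) by (intro subspace_diff)
  ultimately show thesis using z(3)[OF pq(1)] err by (intro that[of "z p - z q" "max M (Suc N)" u]) auto
qed

lemma schreier_blocks_exist:
  assumes Z: "subspace Z" "infinite_dimensional Z"
  obtains y u pos where "schreier_blocks T C K y u pos" "range y \<subseteq> Z"
proof -
  define block where "block j N M y u \<longleftrightarrow> y \<in> Z \<and> 1/2 \<le> norm y \<and> norm y \<le> 2 \<and> N < M \<and>
    schreier_le u (2 * K) \<and> supported_on {N..<M} u \<and> norm (y - T u) \<le> (1/2)^j" for j :: nat and N M y u
  have "\<exists>M y u. block j N M y u" for j N
    by (rule tail_lifted_vector[OF Z, of "(1/2)^j" N]) (auto simp: block_def)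
  then obtain pos where "\<And>j. \<exists>y u. block j (pos j) (pos (Suc j)) y u"
    using dependent_nat_choice[of "\<lambda>_ _. True" "\<lambda>j N M. \<exists>y u. block j N M y u"] by auto
  then obtain y u where yu: "\<And>j. block j (pos j) (pos (Suc j)) (y j) (u j)" by metis
  have "schreier_blocks T C K y u pos"
  proof
    show "strict_mono pos" using yu by (simp add: strict_mono_Suc_iff block_def)
    show "finitely_supported (u j)" for j
      using yu[of j]
      by (intro finitely_supported_if_supported_on[of "{pos j..<pos (Suc j)}"]) (simp_all add: block_def)
  qed (use yu in \<open>simp_all add: block_def\<close>)
  moreover have "range y \<subseteq> Z" using yu by (auto simp: block_def)
  ultimately show thesis by (rule that)
qed

end

lemma (in lifted_sequence) lifted_subsequence:
  assumes "strict_mono s"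
  shows "lifted_sequence T C K (y \<circ> s) (u \<circ> s)"
proof
  fix j
  have "(1/2::real)^(s j) \<le> (1/2)^j"
    using assms by (intro power_decreasing) (auto intro: strict_mono_imp_increasing)
  then show "norm ((y \<circ> s) j - T ((u \<circ> s) j)) \<le> (1/2)^j" using order_trans[OF u_err[of "s j"]] by simp
qed (use y_ge y_le u_finite u_le in auto)

context schreier_blocks
begin

lemma block_subsequence:
  assumes s: "strict_mono s"
  shows "schreier_blocks T C K (y \<circ> s) (u \<circ> s) (pos \<circ> s)"
proof -
  interpret s: lifted_sequence T C K "y \<circ> s" "u \<circ> s" using s by (rule lifted_subsequence)
  show ?thesis
  proof
    show "strict_mono (pos \<circ> s)" using pos s by (rule strict_mono_o)
    fix j
    have "Suc (s j) \<le> s (Suc j)" using s by (simp add: strict_mono_Suc_iff Suc_leI)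
    then have "pos (Suc (s j)) \<le> pos (s (Suc j))" using pos by (simp add: strict_mono_less_eq)
    then show "supported_on {(pos \<circ> s) j..<(pos \<circ> s) (Suc j)} ((u \<circ> s) j)"
      by (auto intro: supported_on_mono[OF u_supp])
  qed
qed

lemma zero_in_closure_hull_blocks: "0 \<in> closure (convex hull (range y))"
  unfolding closure_approachable
proof (intro allI impI)
  fix \<epsilon> :: real assume "0 < \<epsilon>"
  then obtain i where i: "(1/2)^i < \<epsilon> / 2" using real_arch_pow_inv[of "\<epsilon> / 2" "1/2"] by auto
  obtain m :: nat and c :: "nat \<Rightarrow> real" where c: "\<And>j. 0 \<le> c j" "(\<Sum>j<m. c j) = 1"
    and small: "\<And>t. (\<And>j. j < m \<Longrightarrow> supported_on {pos (i + j)..<pos (i + Suc j)} (t j)) \<Longrightarrow>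
      (\<And>j. j < m \<Longrightarrow> schreier_le (t j) (2 * K)) \<Longrightarrow> schreier_le (\<lambda>n. \<Sum>j<m. c j * t j n) (\<epsilon> / (2 * C))"
    by (rule schreier_convex_weights[of "\<lambda>j. pos (i + j)" "2 * K" "\<epsilon> / (2 * C)"])
      (use strict_mono_mono[OF pos] K_pos C_pos \<open>0 < \<epsilon>\<close> in \<open>auto simp: mono_def\<close>)
  have "schreier_le (\<lambda>n. \<Sum>j<m. c j * u (i + j) n) (\<epsilon> / (2 * C))"
    using u_supp[of "i + _"] u_le by (intro small) auto
  then have "norm (T (\<lambda>n. \<Sum>j<m. c j * u (i + j) n)) \<le> C * (\<epsilon> / (2 * C))"
    by (intro T_bound) (simp_all add: u_finite)
  then have main: "norm (\<Sum>j<m. c j *\<^sub>R T (u (i + j))) \<le> \<epsilon> / 2"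
    using C_pos by (simp add: T_sum u_finite)
  have "norm (y (i + j) - T (u (i + j))) \<le> (1/2)^i" for j
    by (rule order_trans[OF u_err]) (simp add: power_decreasing)
  then have err: "norm (\<Sum>j<m. c j *\<^sub>R (y (i + j) - T (u (i + j)))) \<le> (1/2)^i"
    using c by (intro norm_convex_combination_le) auto
  have "(\<Sum>j<m. c j *\<^sub>R y (i + j))
      = (\<Sum>j<m. c j *\<^sub>R T (u (i + j))) + (\<Sum>j<m. c j *\<^sub>R (y (i + j) - T (u (i + j))))"
    by (simp add: scaleR_diff_right sum_subtractf)
  then have "norm (\<Sum>j<m. c j *\<^sub>R y (i + j)) \<le> \<epsilon> / 2 + (1/2)^i"
    using norm_triangle_le[OF add_mono[OF main err]] by simp
  then have "norm (\<Sum>j<m. c j *\<^sub>R y (i + j)) < \<epsilon>" using i by linarith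
  moreover have "(\<Sum>j<m. c j *\<^sub>R y (i + j)) \<in> convex hull (range y)"
    using c by (intro convex_sum convex_convex_hull) (auto intro: hull_inc)
  ultimately show "\<exists>v\<in>convex hull (range y). dist v 0 < \<epsilon>" by (intro bexI) simp_all
qed

lemma convexly_null_blocks: "convexly_null y"
  unfolding convexly_null_def
proof (intro allI impI)
  fix s :: "nat \<Rightarrow> nat" assume "strict_mono s"
  then interpret s: schreier_blocks T C K "y \<circ> s" "u \<circ> s" "pos \<circ> s" by (rule block_subsequence)
  show "0 \<in> closure (convex hull (range (y \<circ> s)))" by (rule s.zero_in_closure_hull_blocks)
qed

lemma seminormalized_blocks: "seminormalized y"
  unfolding seminormalized_def using y_ge y_le by (intro exI[of _ "1/2"] conjI exI[of _ 2]) auto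

end

locale schreier_mazur = schreier_blocks T C K y u pos
  for T :: "(nat \<Rightarrow> real) \<Rightarrow> 'a::banach" and C K y u pos +
  assumes mazur: "m \<le> j \<Longrightarrow> v \<in> span (unit_image ` {..j} \<union> y ` {..j}) \<Longrightarrow> r \<in> span (y ` {j<..}) \<Longrightarrow>
      tail_gauge m v \<le> 2 * tail_gauge m (v + r)"

lemma (in schreier_blocks) schreier_mazur_subsequence:
  obtains s where "strict_mono s" "schreier_mazur T C K (y \<circ> s) (u \<circ> s) (pos \<circ> s)"
proof -
  obtain s where s: "strict_mono s"
    and mazur: "\<And>m j v r. m \<le> j \<Longrightarrow> v \<in> span (unit_image ` {..j} \<union> (y \<circ> s) ` {..j}) \<Longrightarrow>
      r \<in> span ((y \<circ> s) ` {j<..}) \<Longrightarrow>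
      tail_gauge m v \<le> 2 * tail_gauge m (v + r)"
    by (rule mazur_subsequence[OF equivalent_norm_tail_gauge seminormalized_blocks convexly_null_blocks,
          where e = unit_image]) (rule that)
  interpret s: schreier_blocks T C K "y \<circ> s" "u \<circ> s" "pos \<circ> s" using s by (rule block_subsequence)
  have "schreier_mazur T C K (y \<circ> s) (u \<circ> s) (pos \<circ> s)" by unfold_locales (rule mazur)
  with s show thesis by (rule that)
qed

subsection \<open>Gradual cuts\<close>

definition ramp :: "nat \<Rightarrow> nat \<Rightarrow> (nat \<Rightarrow> real) \<Rightarrow> bool" where
  "ramp a b \<phi> \<longleftrightarrow> (\<forall>n. 0 \<le> \<phi> n \<and> \<phi> n \<le> 1) \<and> (\<forall>n<a. \<phi> n = 1) \<and> (\<forall>n\<ge>b. \<phi> n = 0)"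

lemma ramp_convex_combination:
  assumes "\<And>j. 0 \<le> c j" "(\<Sum>j<m. c j) = 1" and k: "\<And>j. j < m \<Longrightarrow> a \<le> k j \<and> k j \<le> b"
  shows "ramp a b (\<lambda>n. \<Sum>j<m. c j * indicator {..<k j} n)"
  unfolding ramp_def
proof (intro conjI allI impI)
  fix n
  show "0 \<le> (\<Sum>j<m. c j * indicator {..<k j} n)" using assms(1) by (intro sum_nonneg) simp
  have "(\<Sum>j<m. c j * indicator {..<k j} n) \<le> (\<Sum>j<m. c j)"
    using assms(1) by (intro sum_mono) (simp add: indicator_def)
  then show "(\<Sum>j<m. c j * indicator {..<k j} n) \<le> 1" by (simp add: assms(2))
  show "(\<Sum>j<m. c j * indicator {..<k j} n) = 1" if "n < a"
  proof -
    have "(\<Sum>j<m. c j * indicator {..<k j} n) = (\<Sum>j<m. c j)"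
      using k that by (intro sum.cong) (force simp: indicator_def)+
    then show ?thesis by (simp add: assms(2))
  qed
  show "(\<Sum>j<m. c j * indicator {..<k j} n) = 0" if "b \<le> n"
    using k that by (intro sum.neutral) (force simp: indicator_def)
qed

lemma (in c00_linear) averaged_cut_error_le:
  fixes c :: "nat \<Rightarrow> real" and k :: "nat \<Rightarrow> nat"
  assumes c: "\<And>j. 0 \<le> c j" "(\<Sum>j<m. c j) = 1" and x: "finitely_supported x"
    and t: "\<And>j. j < m \<Longrightarrow> finitely_supported (t j)" "norm (T (\<lambda>n. \<Sum>j<m. c j * t j n)) \<le> \<delta>"
    and err: "\<And>j. j < m \<Longrightarrow> norm (l - T (\<lambda>n. indicator {..<k j} n * x n) - T (t j)) \<le> \<epsilon>"
  shows "norm (l - T (\<lambda>n. (\<Sum>j<m. c j * indicator {..<k j} n) * x n)) \<le> \<delta> + \<epsilon>"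
proof -
  define d where "d j = l - T (\<lambda>n. indicator {..<k j} n * x n)" for j :: nat
  have "T (\<lambda>n. (\<Sum>j<m. c j * indicator {..<k j} n) * x n)
      = (\<Sum>j<m. c j *\<^sub>R T (\<lambda>n. indicator {..<k j} n * x n))"
    unfolding sum_distrib_right mult.assoc using x by (intro T_sum finitely_supported_mult)
  also have "\<dots> = (\<Sum>j<m. c j) *\<^sub>R l - (\<Sum>j<m. c j *\<^sub>R d j)"
    by (simp add: d_def scaleR_diff_right sum_subtractf scaleR_sum_left)
  also have "(\<Sum>j<m. c j *\<^sub>R d j) = (\<Sum>j<m. c j *\<^sub>R T (t j)) + (\<Sum>j<m. c j *\<^sub>R (d j - T (t j)))"
    by (simp add: scaleR_diff_right sum_subtractf)
  also have "(\<Sum>j<m. c j *\<^sub>R T (t j)) = T (\<lambda>n. \<Sum>j<m. c j * t j n)"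
    by (intro T_sum[symmetric] t) simp
  finally have "l - T (\<lambda>n. (\<Sum>j<m. c j * indicator {..<k j} n) * x n)
      = T (\<lambda>n. \<Sum>j<m. c j * t j n) + (\<Sum>j<m. c j *\<^sub>R (d j - T (t j)))"
    by (simp add: c(2))
  also have "norm \<dots> \<le> \<delta> + \<epsilon>"
    using c err unfolding d_def by (intro norm_triangle_mono t norm_convex_combination_le) auto
  finally show ?thesis .
qed

lemma (in schreier_quotient) uniform_tail_lift:
  assumes G: "finite G"
  obtains h where "k < h" "\<And>d. d \<in> span G \<Longrightarrow> tail_gauge k d \<le> R \<Longrightarrow>
    \<exists>t. supported_on {k..<h} t \<and> schreier_le t (R + 1) \<and> norm (d - T t) \<le> (R + 1) / (real k + 1)"
proof -
  define D where "D = {d \<in> span G. tail_gauge k d \<le> R}"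
  define A where "A = {t. finitely_supported t \<and> supported_on {k..} t \<and> schreier_le t (R + 1)}"
  define U where "U t = {d. (real k + 1) * norm (d - T t) < R + 1}" for t
  have "compact D"
    unfolding D_def by (rule compact_span_equivalent_norm_sublevel[OF equivalent_norm_tail_gauge G])
  moreover have "open (U t)" if "t \<in> A" for t
    unfolding U_def by (intro open_Collect_less continuous_intros)
  moreover have "D \<subseteq> (\<Union>t\<in>A. U t)"
  proof
    fix d assume "d \<in> D"
    then have "tail_gauge k d < R + 1" by (simp add: D_def)
    then obtain t where "finitely_supported t" "supported_on {k..} t" "schreier_le t (R + 1)"
      "(real k + 1) * norm (d - T t) < R + 1"
      by (rule tail_gauge_lessE)
    then show "d \<in> (\<Union>t\<in>A. U t)" by (auto simp: A_def U_def)
  qed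
  ultimately obtain A' where A': "A' \<subseteq> A" "finite A'" "D \<subseteq> (\<Union>t\<in>A'. U t)"
    by (rule compactE_image)
  have "\<exists>M. supported_on {..<M} t" if "t \<in> A'" for t
    using A'(1) that finitely_supported_iff by (auto simp: A_def)
  then obtain M where M: "\<And>t. t \<in> A' \<Longrightarrow> supported_on {..<M t} t" by metis
  define h where "h = Suc k + (\<Sum>t\<in>A'. M t)"
  show thesis
  proof (rule that[of h])
    show "k < h" by (simp add: h_def)
    fix d assume "d \<in> span G" "tail_gauge k d \<le> R"
    then obtain t where t: "t \<in> A'" "d \<in> U t" using A'(3) by (auto simp: D_def)
    have "M t \<le> h" using member_le_sum[OF t(1), of M] A'(2) by (simp add: h_def)
    then have "supported_on {k..<h} t"
      using M[OF t(1)] A'(1) t(1) by (fastforce simp: A_def supported_on_def)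
    moreover have "norm (d - T t) \<le> (R + 1) / (real k + 1)"
      using t(2) by (simp add: U_def pos_le_divide_eq mult.commute)
    ultimately show "\<exists>t. supported_on {k..<h} t \<and> schreier_le t (R + 1) \<and>
      norm (d - T t) \<le> (R + 1) / (real k + 1)"
      using A'(1) t(1) by (auto simp: A_def)
  qed
qed

context schreier_mazur
begin

lemma basic_sequence_mazur: "basic_sequence (2 * (C + 1)) y"
  unfolding basic_sequence_def
proof (intro allI ballI)
  fix j l r assume l: "l \<in> span (y ` {..<j})" and r: "r \<in> span (y ` {j..})"
  have "tail_gauge 0 l \<le> 2 * tail_gauge 0 (l + r)"
  proof (cases j)
    case 0
    then have "l = 0" using l by simp
    moreover have "tail_gauge 0 0 \<le> 0" using tail_gauge_le_norm[of 0 0] by simp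
    ultimately show ?thesis
      using equivalent_norm_nonneg[OF equivalent_norm_tail_gauge, of 0 "l + r"] by simp
  next
    case (Suc i)
    then have "{..<j} = {..i}" "{j..} = {i<..}" by auto
    then show ?thesis
      using l r span_mono[of "y ` {..i}" "unit_image ` {..i} \<union> y ` {..i}"] by (intro mazur[of 0 i]) auto
  qed
  also have "tail_gauge 0 (l + r) \<le> norm (l + r)" using tail_gauge_le_norm[of 0 "l + r"] by simp
  finally have "(C + 1) * tail_gauge 0 l \<le> (C + 1) * (2 * norm (l + r))"
    using C_pos by (intro mult_left_mono) auto
  then show "norm l \<le> 2 * (C + 1) * norm (l + r)"
    using norm_le_tail_gauge[of l 0] by (simp add: algebra_simps)
qed

definition near_lift :: "nat \<Rightarrow> nat \<Rightarrow> real \<Rightarrow> (nat \<Rightarrow> real) \<Rightarrow> 'a \<Rightarrow> bool" where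
  "near_lift a b \<epsilon> x l \<longleftrightarrow> finitely_supported x \<and> schreier_le x K \<and> l \<in> span (y ` {..a}) \<and>
     (\<exists>r\<in>span (y ` {b..}). norm (l + r - T x) \<le> \<epsilon>)"

lemma near_lift_mono:
  assumes "near_lift a b \<epsilon> x l" "a \<le> a'" "b' \<le> b" "\<epsilon> \<le> \<epsilon>'"
  shows "near_lift a' b' \<epsilon>' x l"
proof -
  have "span (y ` {..a}) \<subseteq> span (y ` {..a'})" "span (y ` {b..}) \<subseteq> span (y ` {b'..})"
    using assms(2,3) by (intro span_mono image_mono; auto)+
  then show ?thesis using assms(1,4) unfolding near_lift_def by (meson order_trans subset_iff)
qed

text \<open>After adding \<open>r\<close>, the error of a sharp cut at \<open>k\<close> is close to the image of a bounded vector
  supported in \<open>{k..}\<close>; by the choice of the sequence, adding \<open>r\<close> cannot decrease the gauge much.\<close>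

lemma tail_gauge_sharp_cut:
  assumes "near_lift k (Suc k) (1 / (real k + 1)) x l"
  shows "l - T (\<lambda>n. indicator {..<k} n * x n) \<in> span (unit_image ` {..k} \<union> y ` {..k})" (is "?d \<in> ?V")
    and "tail_gauge k (l - T (\<lambda>n. indicator {..<k} n * x n)) \<le> 2 * (K + 1)"
proof -
  obtain r where x: "finitely_supported x" "schreier_le x K" and l: "l \<in> span (y ` {..k})"
    and r: "r \<in> span (y ` {Suc k..})" "norm (l + r - T x) \<le> 1 / (real k + 1)"
    using assms unfolding near_lift_def by blast
  have "T (\<lambda>n. indicator {..<k} n * x n) \<in> span (unit_image ` {..<k})"
    by (rule T_in_span) (simp add: supported_on_def indicator_def)
  then have "T (\<lambda>n. indicator {..<k} n * x n) \<in> ?V" by (rule subsetD[OF span_mono, rotated]) auto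
  moreover have "l \<in> ?V" using l by (rule subsetD[OF span_mono, rotated]) auto
  ultimately show V: "?d \<in> ?V" by (intro span_diff)
  define t where "t n = indicator {k..} n * x n" for n
  have t: "finitely_supported t" "supported_on {k..} t" "schreier_le t K"
    unfolding t_def[abs_def] using x
    by (auto intro!: schreier_le_weighted simp: supported_on_def indicator_def)
  have "?d + r - T t = l + r - T x"
    using T_split[OF x(1), of k] by (simp add: t_def[abs_def])
  then have "tail_gauge k (?d + r) \<le> K + (real k + 1) * norm (l + r - T x)"
    using tail_gauge_le[OF t, of "?d + r"] by (simp only:)
  also have "(real k + 1) * norm (l + r - T x) \<le> 1"
    using r(2) by (simp add: pos_le_divide_eq mult.commute)
  finally have "2 * tail_gauge k (?d + r) \<le> 2 * (K + 1)" by simp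
  then show "tail_gauge k ?d \<le> 2 * (K + 1)"
    using mazur[OF order_refl V, of r] r(1) by (simp add: atLeast_Suc_greaterThan)
qed

lemma sharp_cut_error_lift:
  obtains h where "k < h" "\<And>x l. near_lift k (Suc k) (1 / (real k + 1)) x l \<Longrightarrow>
    \<exists>t. supported_on {k..<h} t \<and> schreier_le t (2 * K + 3) \<and>
      norm (l - T (\<lambda>n. indicator {..<k} n * x n) - T t) \<le> (2 * K + 3) / (real k + 1)"
proof -
  obtain h where "k < h" "\<And>d. d \<in> span (unit_image ` {..k} \<union> y ` {..k}) \<Longrightarrow> tail_gauge k d \<le> 2 * (K + 1) \<Longrightarrow>
    \<exists>t. supported_on {k..<h} t \<and> schreier_le t (2 * (K + 1) + 1) \<and>
      norm (d - T t) \<le> (2 * (K + 1) + 1) / (real k + 1)"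
    by (rule uniform_tail_lift[of "unit_image ` {..k} \<union> y ` {..k}" k "2 * (K + 1)"]) auto
  moreover have "2 * (K + 1) + 1 = 2 * K + 3" by simp
  ultimately show thesis using tail_gauge_sharp_cut that[of h] by (simp only:)
qed

definition gradual_cut :: "nat \<Rightarrow> nat \<Rightarrow> real \<Rightarrow> (nat \<Rightarrow> real) \<Rightarrow> bool" where
  "gradual_cut a b \<epsilon> \<phi> \<longleftrightarrow> ramp a b \<phi> \<and>
     (\<forall>x l. near_lift a b (1 / (real b + 1)) x l \<longrightarrow> norm (l - T (\<lambda>n. \<phi> n * x n)) \<le> \<epsilon>)"

lemma sharp_cut_positions:
  assumes "0 < \<epsilon>"
  obtains \<kappa> where "strict_mono \<kappa>" "\<And>j. a \<le> \<kappa> j"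
    "\<And>j x l. near_lift (\<kappa> j) (Suc (\<kappa> j)) (1 / (real (\<kappa> j) + 1)) x l \<Longrightarrow>
      \<exists>t. supported_on {\<kappa> j..<\<kappa> (Suc j)} t \<and> schreier_le t (2 * K + 3) \<and>
        norm (l - T (\<lambda>n. indicator {..<\<kappa> j} n * x n) - T t) \<le> \<epsilon>"
proof -
  let ?R = "2 * K + 3"
  obtain k0 :: nat where "?R / \<epsilon> < real k0" using reals_Archimedean2 by blast
  then have "?R < \<epsilon> * real k0" using \<open>0 < \<epsilon>\<close> by (simp add: pos_divide_less_eq mult.commute)
  have k0: "?R / (real k + 1) \<le> \<epsilon>" if "k0 \<le> k" for k
  proof -
    have "\<epsilon> * real k0 \<le> \<epsilon> * (real k + 1)" using \<open>0 < \<epsilon>\<close> that by (intro mult_left_mono) auto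
    then have "?R \<le> \<epsilon> * (real k + 1)" using \<open>?R < \<epsilon> * real k0\<close> by linarith
    then show ?thesis by (simp add: pos_divide_le_eq)
  qed
  define lifts where "lifts k h \<longleftrightarrow> (\<forall>x l. near_lift k (Suc k) (1 / (real k + 1)) x l \<longrightarrow>
    (\<exists>t. supported_on {k..<h} t \<and> schreier_le t ?R \<and>
      norm (l - T (\<lambda>n. indicator {..<k} n * x n) - T t) \<le> ?R / (real k + 1)))" for k h
  have "\<exists>h. k < h \<and> lifts k h" for k
    by (rule sharp_cut_error_lift[of k]) (auto simp: lifts_def)
  then obtain \<kappa> where \<kappa>0: "\<kappa> 0 = max a k0" and \<kappa>_less: "\<And>j. \<kappa> j < \<kappa> (Suc j)"
    and lifts: "\<And>j. lifts (\<kappa> j) (\<kappa> (Suc j))"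
    using dependent_nat_choice[of "\<lambda>n k. n = 0 \<longrightarrow> k = max a k0" "\<lambda>_ k h. k < h \<and> lifts k h"] by auto
  then have \<kappa>: "strict_mono \<kappa>" by (simp add: strict_mono_Suc_iff)
  have \<kappa>_ge: "a \<le> \<kappa> j" "k0 \<le> \<kappa> j" for j using strict_mono_less_eq[OF \<kappa>, of 0 j] \<kappa>0 by auto
  show thesis
    using lifts k0[OF \<kappa>_ge(2)] unfolding lifts_def by (intro that[OF \<kappa> \<kappa>_ge(1)]) (meson order_trans)
qed

text \<open>A single sharp cut need not have a small error, but the errors of sharp cuts at suitable
  positions have bounded successive lifts, so that a convex combination of them is small.\<close>

lemma gradual_cut_exists:
  assumes "0 < \<epsilon>"
  obtains b \<phi> where "a < b" "gradual_cut a b \<epsilon> \<phi>"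
proof -
  obtain \<kappa> where \<kappa>: "strict_mono \<kappa>" "\<And>j. a \<le> \<kappa> j"
    and lifts: "\<And>j x l. near_lift (\<kappa> j) (Suc (\<kappa> j)) (1 / (real (\<kappa> j) + 1)) x l \<Longrightarrow>
      \<exists>t. supported_on {\<kappa> j..<\<kappa> (Suc j)} t \<and> schreier_le t (2 * K + 3) \<and>
        norm (l - T (\<lambda>n. indicator {..<\<kappa> j} n * x n) - T t) \<le> \<epsilon> / 2"
    by (rule sharp_cut_positions[of "\<epsilon> / 2" a]) (use \<open>0 < \<epsilon>\<close> in simp, rule that)
  obtain m :: nat and c :: "nat \<Rightarrow> real" where c: "\<And>j. 0 \<le> c j" "(\<Sum>j<m. c j) = 1"
    and small: "\<And>t. (\<And>j. j < m \<Longrightarrow> supported_on {\<kappa> j..<\<kappa> (Suc j)} (t j)) \<Longrightarrow>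
      (\<And>j. j < m \<Longrightarrow> schreier_le (t j) (2 * K + 3)) \<Longrightarrow> schreier_le (\<lambda>n. \<Sum>j<m. c j * t j n) (\<epsilon> / (2 * C))"
    by (rule schreier_convex_weights[OF strict_mono_mono[OF \<kappa>(1)], of "2 * K + 3" "\<epsilon> / (2 * C)"])
      (use K_pos C_pos \<open>0 < \<epsilon>\<close> in auto)
  define b where "b = Suc (\<kappa> m)"
  define \<phi> where "\<phi> n = (\<Sum>j<m. c j * indicator {..<\<kappa> j} n)" for n
  have \<kappa>_less_b: "\<kappa> j < b" if "j < m" for j
    using strict_mono_less[OF \<kappa>(1), of j m] that by (simp add: b_def)
  have "norm (l - T (\<lambda>n. \<phi> n * x n)) \<le> \<epsilon>" if near: "near_lift a b (1 / (real b + 1)) x l" for x l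
  proof -
    have "near_lift (\<kappa> j) (Suc (\<kappa> j)) (1 / (real (\<kappa> j) + 1)) x l" if "j < m" for j
      using \<kappa>(2)[of j] \<kappa>_less_b[OF that] by (intro near_lift_mono[OF near]) (auto simp: frac_le)
    from lifts[OF this] obtain t where t: "\<And>j. j < m \<Longrightarrow> supported_on {\<kappa> j..<\<kappa> (Suc j)} (t j)"
      "\<And>j. j < m \<Longrightarrow> schreier_le (t j) (2 * K + 3)"
      and err: "\<And>j. j < m \<Longrightarrow> norm (l - T (\<lambda>n. indicator {..<\<kappa> j} n * x n) - T (t j)) \<le> \<epsilon> / 2"
      by metis
    have t_finite: "finitely_supported (t j)" if "j < m" for j
      using t(1)[OF that] by (rule finitely_supported_if_supported_on[rotated]) simp
    have "norm (T (\<lambda>n. \<Sum>j<m. c j * t j n)) \<le> C * (\<epsilon> / (2 * C))"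
      by (intro T_bound finitely_supported_sum finitely_supported_mult small t t_finite) simp_all
    also have "\<dots> = \<epsilon> / 2" using C_pos by simp
    finally have "norm (T (\<lambda>n. \<Sum>j<m. c j * t j n)) \<le> \<epsilon> / 2" .
    moreover have "finitely_supported x" using near by (simp add: near_lift_def)
    ultimately have "norm (l - T (\<lambda>n. \<phi> n * x n)) \<le> \<epsilon> / 2 + \<epsilon> / 2"
      unfolding \<phi>_def by (intro averaged_cut_error_le[OF c _ t_finite _ err])
    then show ?thesis by simp
  qed
  moreover have "ramp a b \<phi>"
    unfolding \<phi>_def[abs_def] using c \<kappa>(2) \<kappa>_less_b
    by (intro ramp_convex_combination) (auto intro: less_imp_le)
  moreover have "a < b" using \<kappa>(2)[of m] by (simp add: b_def)
  ultimately show thesis using that[of b \<phi>] by (simp add: gradual_cut_def)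
qed

lemma gradual_cut_sequence:
  fixes start :: "nat \<Rightarrow> nat"
  assumes "\<And>k. k \<le> start k" "\<And>k. 0 < \<epsilon> k"
  obtains \<kappa> \<phi> where "strict_mono \<kappa>" "\<And>k. start (\<kappa> k) < \<kappa> (Suc k)"
    "\<And>k. gradual_cut (start (\<kappa> k)) (\<kappa> (Suc k)) (\<epsilon> k) (\<phi> k)"
proof -
  have "\<exists>b \<phi>. start a < b \<and> gradual_cut (start a) b (\<epsilon> k) \<phi>" for a k
    by (rule gradual_cut_exists[of "\<epsilon> k" "start a"]) (use assms(2) in auto)
  then obtain next_pos and \<Phi> where next_pos: "\<And>a k. start a < next_pos a k"
    and \<Phi>: "\<And>a k. gradual_cut (start a) (next_pos a k) (\<epsilon> k) (\<Phi> a k)"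
    by metis
  define \<kappa> where "\<kappa> = rec_nat 0 (\<lambda>k a. next_pos a k)"
  have Suc: "\<kappa> (Suc k) = next_pos (\<kappa> k) k" for k by (simp add: \<kappa>_def)
  show thesis
  proof (rule that[of \<kappa> "\<lambda>k. \<Phi> (\<kappa> k) k"])
    show "strict_mono \<kappa>"
      unfolding strict_mono_Suc_iff Suc using assms(1) next_pos le_less_trans by blast
  qed (simp_all add: Suc next_pos \<Phi>)
qed

end

locale schreier_ramps = lifted_sequence T C K y u
  for T :: "(nat \<Rightarrow> real) \<Rightarrow> 'a::banach" and C K y u +
  fixes D :: real and \<kappa> :: "nat \<Rightarrow> nat" and \<phi> :: "nat \<Rightarrow> nat \<Rightarrow> real"
  assumes D_pos: "0 < D" and basic: "basic_sequence D y" and \<kappa>: "strict_mono \<kappa>"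
    and u_supp: "supported_on {\<kappa> k..<\<kappa> (Suc (Suc k))} (u k)"
    and ramp: "ramp (\<kappa> k) (\<kappa> (Suc k)) (\<phi> k)"
    and cut: "finitely_supported x \<Longrightarrow> schreier_le x K \<Longrightarrow>
      l \<in> span (y ` {..<k}) \<Longrightarrow> r \<in> span (y ` {k..}) \<Longrightarrow>
      norm (l + r - T x) \<le> 1 / (real (\<kappa> (Suc k)) + 1) \<Longrightarrow> norm (l - T (\<lambda>n. \<phi> k n * x n)) \<le> (1/2)^k"

lemma (in schreier_mazur) schreier_ramps_subsequence:
  obtains s D \<kappa> \<phi> where "schreier_ramps T C K (y \<circ> s) (u \<circ> s) D \<kappa> \<phi>"
proof -
  define start where "start k = max k (pos (Suc k))" for k
  have start_ge: "k \<le> start k" "pos (Suc k) \<le> start k" for k by (simp_all add: start_def)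
  obtain \<kappa> \<phi> where \<kappa>: "strict_mono \<kappa>" and start_less: "\<And>k. start (\<kappa> k) < \<kappa> (Suc k)"
    and \<phi>: "\<And>k. gradual_cut (start (\<kappa> k)) (\<kappa> (Suc k)) ((1/2)^k) (\<phi> k)"
    by (rule gradual_cut_sequence[of start "\<lambda>k. (1/2)^k"]) (use start_ge in auto)
  define s where "s k = \<kappa> (Suc k)" for k
  have s: "strict_mono s" using \<kappa> by (simp add: s_def strict_mono_def)
  interpret s: lifted_sequence T C K "y \<circ> s" "u \<circ> s" using s by (rule lifted_subsequence)
  have "schreier_ramps T C K (y \<circ> s) (u \<circ> s) (2 * (C + 1)) \<kappa> \<phi>"
  proof
    show "0 < 2 * (C + 1)" using C_pos by simp
    show "basic_sequence (2 * (C + 1)) (y \<circ> s)"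
      by (rule basic_sequence_subseq[OF basic_sequence_mazur s])
    show "strict_mono \<kappa>" by (rule \<kappa>)
    fix k
    have "\<kappa> k \<le> s k" using \<kappa> by (simp add: s_def strict_mono_less_eq)
    then have "\<kappa> k \<le> pos (s k)" using strict_mono_imp_increasing[OF pos] order_trans by blast
    moreover have "pos (Suc (s k)) \<le> \<kappa> (Suc (Suc k))"
      using start_ge(2)[of "\<kappa> (Suc k)"] start_less[of "Suc k"] by (simp add: s_def)
    ultimately show "supported_on {\<kappa> k..<\<kappa> (Suc (Suc k))} ((u \<circ> s) k)"
      by (auto intro: supported_on_mono[OF u_supp])
    show "ramp (\<kappa> k) (\<kappa> (Suc k)) (\<phi> k)"
      using \<phi>[of k] start_ge(1)[of "\<kappa> k"] unfolding gradual_cut_def ramp_def by auto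
    fix x l r
    assume x: "finitely_supported x" "schreier_le x K"
      and l: "l \<in> span ((y \<circ> s) ` {..<k})" and r: "r \<in> span ((y \<circ> s) ` {k..})"
      and err: "norm (l + r - T x) \<le> 1 / (real (\<kappa> (Suc k)) + 1)"
    have "s i \<le> start (\<kappa> k)" if "i < k" for i
      using strict_mono_less_eq[OF \<kappa>, of "Suc i" k] that start_ge(1)[of "\<kappa> k"] by (simp add: s_def)
    then have "(y \<circ> s) ` {..<k} \<subseteq> y ` {..start (\<kappa> k)}" by auto
    then have "l \<in> span (y ` {..start (\<kappa> k)})" using l span_mono by blast
    moreover have "(y \<circ> s) ` {k..} \<subseteq> y ` {\<kappa> (Suc k)..}"
      using \<kappa> by (auto simp: s_def strict_mono_less_eq)
    then have "r \<in> span (y ` {\<kappa> (Suc k)..})" using r span_mono by blast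
    ultimately have "near_lift (start (\<kappa> k)) (\<kappa> (Suc k)) (1 / (real (\<kappa> (Suc k)) + 1)) x l"
      unfolding near_lift_def using x err by blast
    then show "norm (l - T (\<lambda>n. \<phi> k n * x n)) \<le> (1/2)^k"
      using \<phi>[of k] unfolding gradual_cut_def by blast
  qed
  then show thesis by (rule that)
qed

subsection \<open>Lifts with small coordinates\<close>

context schreier_ramps
begin

lemma \<kappa>_mono: "i \<le> j \<Longrightarrow> \<kappa> i \<le> \<kappa> j"
  using \<kappa> by (simp add: strict_mono_less_eq)

definition piece :: "nat \<Rightarrow> nat \<Rightarrow> real" where
  "piece k n = \<phi> (Suc k) n - \<phi> k n"

lemma ramp_bounds: "0 \<le> \<phi> k n" "\<phi> k n \<le> 1"
  and ramp_eq_1: "n < \<kappa> k \<Longrightarrow> \<phi> k n = 1"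
  and ramp_eq_0: "\<kappa> (Suc k) \<le> n \<Longrightarrow> \<phi> k n = 0"
  using ramp[of k] by (auto simp: ramp_def)

lemma piece_nonneg: "0 \<le> piece k n"
  using ramp_bounds[of "Suc k" n] ramp_bounds[of k n] ramp_eq_1[of n "Suc k"] ramp_eq_0[of k n]
  by (cases "n < \<kappa> (Suc k)") (auto simp: piece_def)

lemma supported_on_piece: "supported_on {\<kappa> k..<\<kappa> (Suc (Suc k))} (piece k)"
proof -
  have "piece k n = 0" if "n < \<kappa> k" for n
    using that \<kappa>_mono[of k "Suc k"] by (simp add: piece_def ramp_eq_1)
  moreover have "piece k n = 0" if "\<kappa> (Suc (Suc k)) \<le> n" for n
    using that \<kappa>_mono[of "Suc k" "Suc (Suc k)"] by (simp add: piece_def ramp_eq_0)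
  ultimately show ?thesis unfolding supported_on_def by (meson atLeastLessThan_iff not_le)
qed

lemma sum_pieces_bounds:
  assumes "finite G"
  shows "0 \<le> (\<Sum>k\<in>G. piece k n)" "(\<Sum>k\<in>G. piece k n) \<le> 1"
proof -
  show "0 \<le> (\<Sum>k\<in>G. piece k n)" by (intro sum_nonneg piece_nonneg)
  obtain b where "G \<subseteq> {..<b}" using assms finite_nat_iff_bounded by blast
  then have "(\<Sum>k\<in>G. piece k n) \<le> (\<Sum>k<b. piece k n)" using piece_nonneg by (intro sum_mono2) auto
  also have "\<dots> = \<phi> b n - \<phi> 0 n" unfolding piece_def by (rule sum_lessThan_telescope)
  also have "\<dots> \<le> 1" using ramp_bounds[of b n] ramp_bounds[of 0 n] by linarith
  finally show "(\<Sum>k\<in>G. piece k n) \<le> 1" .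
qed

lemma card_pieces_at_le:
  shows "finite {k. piece k n \<noteq> 0}" "card {k. piece k n \<noteq> 0} \<le> 2"
proof -
  obtain i where sub: "{k. piece k n \<noteq> 0} \<subseteq> {i, Suc i}"
  proof (cases "\<exists>k. piece k n \<noteq> 0")
    case True
    define i where "i = (LEAST k. piece k n \<noteq> 0)"
    have "piece i n \<noteq> 0" unfolding i_def using True by (rule LeastI_ex)
    then have i: "n < \<kappa> (Suc (Suc i))" using supported_on_eq_0[OF supported_on_piece[of i]] by force
    have "k \<in> {i, Suc i}" if "piece k n \<noteq> 0" for k
    proof -
      have "\<kappa> k \<le> n" using that supported_on_eq_0[OF supported_on_piece[of k]] by force
      then have "k < Suc (Suc i)" using i \<kappa>_mono[of "Suc (Suc i)" k] by linarith
      moreover have "i \<le> k" unfolding i_def using that by (rule Least_le)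
      ultimately show ?thesis by auto
    qed
    then show ?thesis using that by blast
  qed (use that in blast)
  then show "finite {k. piece k n \<noteq> 0}" by (rule finite_subset) simp
  have "card {k. piece k n \<noteq> 0} \<le> card {i, Suc i}" using sub by (intro card_mono) auto
  then show "card {k. piece k n \<noteq> 0} \<le> 2" by simp
qed

definition large_pieces :: "(nat \<Rightarrow> real) \<Rightarrow> real \<Rightarrow> nat set" where
  "large_pieces x \<eta> = {k. \<exists>n. piece k n \<noteq> 0 \<and> \<eta> \<le> \<bar>x n\<bar>}"

lemma card_large_pieces_le:
  assumes x: "finitely_supported x" "schreier_le x s" and \<eta>: "0 < \<eta>"
  shows "finite (large_pieces x \<eta>)" "card (large_pieces x \<eta>) \<le> 4 * s / \<eta>"
proof -
  define F where "F = {n. \<eta> \<le> \<bar>x n\<bar>}"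
  have "F \<subseteq> {n. x n \<noteq> 0}" using \<eta> by (auto simp: F_def)
  then have "finite F" using x(1) finite_subset unfolding finitely_supported_def by blast
  have eq: "large_pieces x \<eta> = (\<Union>n\<in>F. {k. piece k n \<noteq> 0})" by (auto simp: large_pieces_def F_def)
  show "finite (large_pieces x \<eta>)" unfolding eq using \<open>finite F\<close> card_pieces_at_le(1) by blast
  have "card (large_pieces x \<eta>) \<le> (\<Sum>n\<in>F. card {k. piece k n \<noteq> 0})"
    unfolding eq by (rule card_UN_le[OF \<open>finite F\<close>])
  also have "\<dots> \<le> (\<Sum>n\<in>F. 2)" by (intro sum_mono card_pieces_at_le)
  finally have "real (card (large_pieces x \<eta>)) \<le> 2 * real (card F)" by simp
  also have "\<dots> \<le> 2 * (2 * s / \<eta>)"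
    using card_large_coordinates_le[OF x(2) \<eta> \<open>finite F\<close>] by (simp add: F_def)
  finally show "card (large_pieces x \<eta>) \<le> 4 * s / \<eta>" by simp
qed

lemma sum_small_pieces:
  assumes x: "schreier_le x s" and G: "finite G" "G \<inter> large_pieces x \<eta> = {}" and "0 \<le> \<eta>"
  shows "schreier_le (\<lambda>n. \<Sum>k\<in>G. piece k n * x n) s" "\<bar>\<Sum>k\<in>G. piece k n * x n\<bar> \<le> \<eta>"
proof -
  have weight: "\<bar>\<Sum>k\<in>G. piece k n\<bar> \<le> 1" for n using sum_pieces_bounds[OF G(1), of n] by simp
  show "schreier_le (\<lambda>n. \<Sum>k\<in>G. piece k n * x n) s"
    unfolding sum_distrib_right[symmetric] using x weight by (rule schreier_le_weighted)
  show "\<bar>\<Sum>k\<in>G. piece k n * x n\<bar> \<le> \<eta>"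
  proof (cases "\<exists>k\<in>G. piece k n \<noteq> 0")
    case True
    then have "\<bar>x n\<bar> \<le> \<eta>" using G(2) by (force simp: large_pieces_def)
    then have "\<bar>\<Sum>k\<in>G. piece k n\<bar> * \<bar>x n\<bar> \<le> 1 * \<eta>" using weight by (intro mult_mono) auto
    then show ?thesis by (simp add: abs_mult flip: sum_distrib_right)
  qed (use \<open>0 \<le> \<eta>\<close> in simp)
qed

lemma schreier_le_large_part:
  assumes x: "finitely_supported x" "schreier_le x K" and \<eta>: "0 < \<eta>" and "0 \<le> \<delta>"
    and G: "G \<subseteq> large_pieces x \<eta>" "\<And>k. k \<in> G \<Longrightarrow> \<bar>c k\<bar> \<le> \<delta>"
  shows "schreier_le (\<lambda>n. \<Sum>k\<in>G. c k * u k n) (8 * K\<^sup>2 * \<delta> / \<eta>)"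
proof (rule schreier_le_mono)
  show "schreier_le (\<lambda>n. \<Sum>k\<in>G. c k * u k n) (\<Sum>k\<in>G. \<bar>c k\<bar> * (2 * K))"
    by (intro schreier_le_sum schreier_le_cmult u_le)
  have "(\<Sum>k\<in>G. \<bar>c k\<bar> * (2 * K)) \<le> card G * (\<delta> * (2 * K))"
    using G(2) K_pos by (intro sum_bounded_above mult_right_mono) auto
  also have "\<dots> \<le> (4 * K / \<eta>) * (\<delta> * (2 * K))"
  proof (rule mult_right_mono)
    have "card G \<le> card (large_pieces x \<eta>)"
      using card_large_pieces_le(1)[OF x \<eta>] G(1) by (rule card_mono)
    also have "real (card (large_pieces x \<eta>)) \<le> 4 * K / \<eta>" using x \<eta> by (rule card_large_pieces_le)
    finally show "real (card G) \<le> 4 * K / \<eta>" by simp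
  qed (use \<open>0 \<le> \<delta>\<close> K_pos in simp)
  also have "\<dots> = 8 * K\<^sup>2 * \<delta> / \<eta>" by (simp add: power2_eq_square)
  finally show "(\<Sum>k\<in>G. \<bar>c k\<bar> * (2 * K)) \<le> 8 * K\<^sup>2 * \<delta> / \<eta>" .
qed

lemma piece_lifts_summand:
  assumes x: "finitely_supported x" "schreier_le x K"
    and err: "norm ((\<Sum>k=a..<b. c k *\<^sub>R y k) - T x) \<le> 1 / (real (\<kappa> (Suc b)) + 1)"
    and k: "a \<le> k" "k < b"
  shows "norm (c k *\<^sub>R y k - T (\<lambda>n. piece k n * x n)) \<le> 2 * (1/2)^k"
proof -
  define l where "l j = (\<Sum>i=a..<j. c i *\<^sub>R y i)" for j
  have cut_le: "norm (l j - T (\<lambda>n. \<phi> j n * x n)) \<le> (1/2)^j" if j: "a \<le> j" "j \<le> b" for j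
  proof (rule cut[OF x])
    show "l j \<in> span (y ` {..<j})" unfolding l_def by (intro span_sum span_scale[OF span_base]) auto
    show "(\<Sum>i=j..<b. c i *\<^sub>R y i) \<in> span (y ` {j..})" by (intro span_sum span_scale[OF span_base]) auto
    have "norm (l j + (\<Sum>i=j..<b. c i *\<^sub>R y i) - T x) \<le> 1 / (real (\<kappa> (Suc b)) + 1)"
      unfolding l_def using j err by (simp add: sum.atLeastLessThan_concat)
    also have "\<dots> \<le> 1 / (real (\<kappa> (Suc j)) + 1)"
      using j(2) \<kappa>_mono[of "Suc j" "Suc b"] by (simp add: frac_le)
    finally show "norm (l j + (\<Sum>i=j..<b. c i *\<^sub>R y i) - T x) \<le> 1 / (real (\<kappa> (Suc j)) + 1)" .
  qed
  have "T (\<lambda>n. piece k n * x n) = T (\<lambda>n. \<phi> (Suc k) n * x n) - T (\<lambda>n. \<phi> k n * x n)"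
    unfolding piece_def left_diff_distrib using x(1) by (intro T_diff finitely_supported_mult)
  moreover have "c k *\<^sub>R y k = l (Suc k) - l k" unfolding l_def using k by simp
  ultimately have "c k *\<^sub>R y k - T (\<lambda>n. piece k n * x n)
      = (l (Suc k) - T (\<lambda>n. \<phi> (Suc k) n * x n)) - (l k - T (\<lambda>n. \<phi> k n * x n))"
    by simp
  also have "norm \<dots> \<le> (1/2)^Suc k + (1/2)^k"
    using k by (intro order_trans[OF norm_triangle_ineq4] add_mono cut_le) auto
  also have "\<dots> \<le> 2 * (1/2)^k" by simp
  finally show ?thesis .
qed

lemma mixed_lift_error_le:
  assumes x: "finitely_supported x" "schreier_le x K"
    and err: "norm ((\<Sum>k=a..<b. c k *\<^sub>R y k) - T x) \<le> 1 / (real (\<kappa> (Suc b)) + 1)"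
    and c: "\<And>k. k \<in> {a..<b} \<Longrightarrow> \<bar>c k\<bar> \<le> 1"
  shows "norm ((\<Sum>k=a..<b. c k *\<^sub>R y k)
      - T (\<lambda>n. (\<Sum>k\<in>{a..<b} - H. piece k n * x n) + (\<Sum>k\<in>{a..<b} \<inter> H. c k * u k n))) \<le> 4 * (1/2)^a"
proof -
  define t where "t k = (if k \<in> H then c k *\<^sub>R T (u k) else T (\<lambda>n. piece k n * x n))" for k
  have "T (\<lambda>n. (\<Sum>k\<in>{a..<b} - H. piece k n * x n) + (\<Sum>k\<in>{a..<b} \<inter> H. c k * u k n))
      = (\<Sum>k\<in>{a..<b} - H. T (\<lambda>n. piece k n * x n)) + (\<Sum>k\<in>{a..<b} \<inter> H. c k *\<^sub>R T (u k))"
    using T_sum[of "{a..<b} - H" "\<lambda>k n. piece k n * x n" "\<lambda>_. 1"] T_sum[of "{a..<b} \<inter> H" u c]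
      x(1) u_finite by (subst T_add) auto
  also have "\<dots> = (\<Sum>k\<in>{a..<b} - H. t k) + (\<Sum>k\<in>{a..<b} \<inter> H. t k)" by (simp add: t_def)
  also have "\<dots> = (\<Sum>k=a..<b. t k)" by (subst sum.Int_Diff[of _ _ H]) simp_all
  finally have "(\<Sum>k=a..<b. c k *\<^sub>R y k)
      - T (\<lambda>n. (\<Sum>k\<in>{a..<b} - H. piece k n * x n) + (\<Sum>k\<in>{a..<b} \<inter> H. c k * u k n))
      = (\<Sum>k=a..<b. c k *\<^sub>R y k - t k)"
    by (simp add: sum_subtractf)
  also have "norm \<dots> \<le> (\<Sum>k=a..<b. 2 * (1/2)^k)"
  proof (rule sum_norm_le)
    fix k assume k: "k \<in> {a..<b}"
    show "norm (c k *\<^sub>R y k - t k) \<le> 2 * (1/2)^k"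
    proof (cases "k \<in> H")
      case True
      then have "norm (c k *\<^sub>R y k - t k) = \<bar>c k\<bar> * norm (y k - T (u k))"
        by (simp add: t_def flip: scaleR_diff_right)
      also have "\<dots> \<le> 1 * (1/2)^k" using c[OF k] by (intro mult_mono u_err) auto
      also have "\<dots> \<le> 2 * (1/2)^k" by simp
      finally show ?thesis .
    next
      case False
      then show ?thesis using piece_lifts_summand[OF x err] k by (simp add: t_def)
    qed
  qed
  also have "\<dots> \<le> 4 * (1/2)^a"
  proof (cases "a \<le> b")
    case True
    then have "(\<Sum>k=a..<b. 2 * (1/2::real)^k) = 4 * (1/2)^a - 4 * (1/2)^b"
      by (induction b rule: dec_induct) auto
    then show ?thesis by simp
  qed simp
  finally show ?thesis .
qed

end

definition (in schreier_quotient) small_lift :: "real \<Rightarrow> 'a \<Rightarrow> nat \<Rightarrow> nat \<Rightarrow> (nat \<Rightarrow> real) \<Rightarrow> bool" where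
  "small_lift \<eta> w lo hi v \<longleftrightarrow> supported_on {lo..<hi} v \<and> schreier_le v (K + 1) \<and>
     (\<forall>n. \<bar>v n\<bar> \<le> \<eta>) \<and> norm (w - T v) \<le> \<eta>"

text \<open>Only boundedly many pieces of a bounded lift have a large coordinate, and these may be
  replaced by \<open>c k\<close> times \<open>u k\<close>, which is tiny.\<close>

lemma (in schreier_ramps) small_lift_if_coefficients_le:
  assumes \<eta>: "0 < \<eta>" "\<eta> \<le> 1" "4 * (1/2)^a \<le> \<eta>"
    and \<delta>: "0 \<le> \<delta>" "\<delta> \<le> 1" "32 * K\<^sup>2 * \<delta> \<le> \<eta>\<^sup>2" and c: "\<And>k. k \<in> {a..<b} \<Longrightarrow> \<bar>c k\<bar> \<le> \<delta>"
    and norm_le: "norm (\<Sum>k=a..<b. c k *\<^sub>R y k) \<le> 1"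
  shows "\<exists>v. small_lift \<eta> (\<Sum>k=a..<b. c k *\<^sub>R y k) (\<kappa> a) (\<kappa> (Suc b)) v"
proof -
  obtain x where x: "finitely_supported x" "schreier_le x (K * norm (\<Sum>k=a..<b. c k *\<^sub>R y k))"
    and err: "norm ((\<Sum>k=a..<b. c k *\<^sub>R y k) - T x) < 1 / (real (\<kappa> (Suc b)) + 1)"
    using approximate_lift[of "1 / (real (\<kappa> (Suc b)) + 1)"] by auto
  have x_le: "schreier_le x K" using x(2) by (rule schreier_le_mono) (use norm_le K_pos in simp)
  define H where "H = large_pieces x (\<eta> / 2)"
  define v1 where "v1 n = (\<Sum>k\<in>{a..<b} - H. piece k n * x n)" for n
  define v2 where "v2 n = (\<Sum>k\<in>{a..<b} \<inter> H. c k * u k n)" for n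
  have v1: "schreier_le v1 K" "\<bar>v1 n\<bar> \<le> \<eta> / 2" for n
    unfolding v1_def[abs_def] using \<eta>(1)
    by (intro sum_small_pieces[OF x_le, of _ "\<eta> / 2"]; auto simp: H_def)+
  have "schreier_le v2 (8 * K\<^sup>2 * \<delta> / (\<eta> / 2))"
    unfolding v2_def[abs_def] H_def using x(1) x_le \<eta>(1) \<delta>(1) c by (intro schreier_le_large_part) auto
  moreover have "8 * K\<^sup>2 * \<delta> / (\<eta> / 2) \<le> \<eta> / 2"
    using \<delta>(3) \<eta>(1) by (simp add: field_simps power2_eq_square)
  ultimately have v2: "schreier_le v2 (\<eta> / 2)" by (rule schreier_le_mono)
  have "small_lift \<eta> (\<Sum>k=a..<b. c k *\<^sub>R y k) (\<kappa> a) (\<kappa> (Suc b)) (\<lambda>n. v1 n + v2 n)"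
    unfolding small_lift_def
  proof (intro conjI allI)
    have "{\<kappa> k..<\<kappa> (Suc (Suc k))} \<subseteq> {\<kappa> a..<\<kappa> (Suc b)}" if "k \<in> {a..<b}" for k
      using that \<kappa>_mono[of a k] \<kappa>_mono[of "Suc (Suc k)" "Suc b"] by auto
    then have "supported_on {\<kappa> a..<\<kappa> (Suc b)} (piece k)" "supported_on {\<kappa> a..<\<kappa> (Suc b)} (u k)"
      if "k \<in> {a..<b}" for k
      using that supported_on_mono[OF supported_on_piece] supported_on_mono[OF u_supp] by blast+
    then show "supported_on {\<kappa> a..<\<kappa> (Suc b)} (\<lambda>n. v1 n + v2 n)"
      unfolding v1_def v2_def mult.commute[of "piece _ _"]
      by (intro supported_on_add supported_on_sum supported_on_mult) auto
    show "schreier_le (\<lambda>n. v1 n + v2 n) (K + 1)"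
      by (rule schreier_le_mono[OF schreier_le_add[OF v1(1) v2]]) (use \<eta> in simp)
    show "\<bar>v1 n + v2 n\<bar> \<le> \<eta>" for n using v1(2)[of n] abs_le_schreier_le[OF v2, of n] by linarith
    have "norm ((\<Sum>k=a..<b. c k *\<^sub>R y k) - T (\<lambda>n. v1 n + v2 n)) \<le> 4 * (1/2)^a"
      unfolding v1_def v2_def using c \<delta>(2) less_imp_le[OF err]
      by (intro mixed_lift_error_le x x_le) force+
    then show "norm ((\<Sum>k=a..<b. c k *\<^sub>R y k) - T (\<lambda>n. v1 n + v2 n)) \<le> \<eta>" using \<eta>(3) by linarith
  qed
  then show ?thesis by (intro exI)
qed

lemma (in schreier_ramps) small_lift_if_small_coefficients:
  assumes \<eta>: "0 < \<eta>" "\<eta> \<le> 1"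
  obtains \<delta> a0 where "0 < \<delta>" "\<And>a b c. a0 \<le> a \<Longrightarrow> \<forall>k\<in>{a..<b}. \<bar>c k\<bar> \<le> \<delta> \<Longrightarrow>
    norm (\<Sum>k=a..<b. c k *\<^sub>R y k) \<le> 1 \<Longrightarrow>
    \<exists>v. small_lift \<eta> (\<Sum>k=a..<b. c k *\<^sub>R y k) (\<kappa> a) (\<kappa> (Suc b)) v"
proof -
  define \<delta> where "\<delta> = min 1 (\<eta>\<^sup>2 / (32 * K\<^sup>2))"
  have \<delta>: "0 < \<delta>" "\<delta> \<le> 1" "32 * K\<^sup>2 * \<delta> \<le> \<eta>\<^sup>2"
    using \<eta> K_pos by (auto simp: \<delta>_def min_def field_simps)
  obtain a0 where a0: "(1/2::real)^a0 < \<eta> / 4" using real_arch_pow_inv[of "\<eta> / 4" "1/2"] \<eta> by auto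
  have small: "4 * (1/2)^a \<le> \<eta>" if "a0 \<le> a" for a
  proof -
    have "(1/2::real)^a \<le> (1/2)^a0" using that by (intro power_decreasing) auto
    then show ?thesis using a0 by linarith
  qed
  show thesis
    by (rule that[OF \<delta>(1)], rule small_lift_if_coefficients_le[OF \<eta> small _ \<delta>(2,3)]) (use \<delta>(1) in auto)
qed

subsection \<open>Blocks with an upper estimate\<close>

lemma (in schreier_quotient) upper_c0_estimate_if_small_lifts:
  assumes lo: "strict_mono lo"
    and v: "\<And>j. small_lift ((1/2)^j / (real (lo j) + 1)) (w j) (lo j) (lo (Suc j)) (v j)"
  shows "upper_c0_estimate (C * (K + 3) + 2) w"
  unfolding upper_c0_estimate_def
proof (intro allI impI)
  fix m and b :: "nat \<Rightarrow> real" assume "\<forall>j<m. \<bar>b j\<bar> \<le> 1"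
  then have b: "\<bar>b j\<bar> \<le> 1" if "j < m" for j using that by simp
  have supp: "supported_on {lo j..<lo (Suc j)} (v j)" and v_le: "schreier_le (v j) (K + 1)"
    and small: "\<bar>v j n\<bar> * lo j \<le> (1/2)^j" and err: "norm (w j - T (v j)) \<le> (1/2)^j" for j n
  proof -
    show "supported_on {lo j..<lo (Suc j)} (v j)" "schreier_le (v j) (K + 1)"
      using v[of j] by (simp_all add: small_lift_def)
    have "\<bar>v j n\<bar> * (real (lo j) + 1) \<le> (1/2)^j"
      using v[of j] by (simp add: small_lift_def pos_le_divide_eq)
    then show "\<bar>v j n\<bar> * lo j \<le> (1/2)^j" by (rule order_trans[rotated]) (simp add: mult_left_mono)
    have "(1/2)^j / (real (lo j) + 1) \<le> (1/2)^j / 1" by (rule divide_left_mono) auto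
    then show "norm (w j - T (v j)) \<le> (1/2)^j" using v[of j] by (simp add: small_lift_def)
  qed
  have v_finite: "finitely_supported (v j)" for j
    using supp[of j] by (rule finitely_supported_if_supported_on[rotated]) simp
  have geometric: "(\<Sum>j<m. (1/2::real)^j) \<le> 2" by (simp add: sum_gp_strict)
  have "schreier_le (\<lambda>n. \<Sum>j<m. b j * v j n) (K + 1 + (\<Sum>j<m. (1/2)^j))"
  proof (rule schreier_le_sum_blocks[OF strict_mono_mono[OF lo]])
    fix j n assume j: "j < m"
    show "supported_on {lo j..<lo (Suc j)} (\<lambda>n. b j * v j n)" by (rule supported_on_mult[OF supp])
    show "schreier_le (\<lambda>n. b j * v j n) (K + 1)" by (rule schreier_le_weighted[OF v_le b[OF j]])
    have "\<bar>b j\<bar> * (\<bar>v j n\<bar> * lo j) \<le> 1 * (1/2)^j" using b[OF j] small[of j n] by (intro mult_mono) auto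
    then show "\<bar>b j * v j n\<bar> * lo j \<le> (1/2)^j" by (simp add: abs_mult mult.assoc)
  qed (use K_pos in simp)
  then have "schreier_le (\<lambda>n. \<Sum>j<m. b j * v j n) (K + 3)"
    by (rule schreier_le_mono) (use geometric in simp)
  then have "norm (T (\<lambda>n. \<Sum>j<m. b j * v j n)) \<le> C * (K + 3)"
    by (rule T_bound[rotated]) (simp add: v_finite)
  then have main: "norm (\<Sum>j<m. b j *\<^sub>R T (v j)) \<le> C * (K + 3)" by (simp add: T_sum v_finite)
  have "norm (b j *\<^sub>R (w j - T (v j))) \<le> 1 * (1/2)^j" if "j < m" for j
    unfolding norm_scaleR using b[OF that] err[of j] by (intro mult_mono) auto
  then have "norm (\<Sum>j<m. b j *\<^sub>R (w j - T (v j))) \<le> (\<Sum>j<m. 1 * (1/2)^j)" by (intro sum_norm_le) simp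
  then have rest: "norm (\<Sum>j<m. b j *\<^sub>R (w j - T (v j))) \<le> 2" using geometric by simp
  have "(\<Sum>j<m. b j *\<^sub>R w j) = (\<Sum>j<m. b j *\<^sub>R T (v j)) + (\<Sum>j<m. b j *\<^sub>R (w j - T (v j)))"
    by (simp add: scaleR_diff_right sum_subtractf)
  then show "norm (\<Sum>j<m. b j *\<^sub>R w j) \<le> C * (K + 3) + 2"
    using norm_triangle_le[OF add_mono[OF main rest]] by simp
qed

lemma upper_c0_estimate_shift:
  assumes "0 < \<delta>" and upper: "\<And>b c. \<forall>k\<in>{a..<b}. \<bar>c k\<bar> \<le> \<delta> \<Longrightarrow> norm (\<Sum>k=a..<b. c k *\<^sub>R y k) \<le> 1"
  shows "upper_c0_estimate (1 / \<delta>) (\<lambda>j. y (a + j))"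
  unfolding upper_c0_estimate_def
proof (intro allI impI)
  fix m and b :: "nat \<Rightarrow> real" assume b: "\<forall>j<m. \<bar>b j\<bar> \<le> 1"
  have "norm (\<Sum>k=a..<a + m. (\<delta> * b (k - a)) *\<^sub>R y k) \<le> 1"
    using b \<open>0 < \<delta>\<close> by (intro upper) (auto simp: abs_mult mult_le_cancel_left1)
  also have "(\<Sum>k=a..<a + m. (\<delta> * b (k - a)) *\<^sub>R y k) = \<delta> *\<^sub>R (\<Sum>j<m. b j *\<^sub>R y (a + j))"
    using sum.shift_bounds_nat_ivl[of "\<lambda>k. (\<delta> * b (k - a)) *\<^sub>R y k" 0 a m]
    by (simp add: lessThan_atLeast0 add.commute scaleR_sum_right)
  finally show "norm (\<Sum>j<m. b j *\<^sub>R y (a + j)) \<le> 1 / \<delta>" using \<open>0 < \<delta>\<close> by (simp add: field_simps)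
qed

context schreier_ramps
begin

lemma normalized_block_with_small_lift:
  assumes large: "\<And>\<delta> a. 0 < \<delta> \<Longrightarrow> \<exists>b c. (\<forall>k\<in>{a..<b}. \<bar>c k\<bar> \<le> \<delta>) \<and> 1 < norm (\<Sum>k=a..<b. c k *\<^sub>R y k)"
    and \<eta>: "0 < \<eta>" "\<eta> \<le> 1"
  obtains hi w v where "lo < hi" "w \<in> span (y ` {lo..<hi})" "norm w = 1" "small_lift \<eta> w lo hi v"
proof -
  obtain \<delta> a0 where \<delta>: "0 < \<delta>" and small: "\<And>a b c. a0 \<le> a \<Longrightarrow> \<forall>k\<in>{a..<b}. \<bar>c k\<bar> \<le> \<delta> \<Longrightarrow>
    norm (\<Sum>k=a..<b. c k *\<^sub>R y k) \<le> 1 \<Longrightarrow> \<exists>v. small_lift \<eta> (\<Sum>k=a..<b. c k *\<^sub>R y k) (\<kappa> a) (\<kappa> (Suc b)) v"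
    using small_lift_if_small_coefficients[OF \<eta>] by blast
  define a where "a = max a0 lo"
  obtain b c where c: "\<forall>k\<in>{a..<b}. \<bar>c k\<bar> \<le> \<delta>" and gt: "1 < norm (\<Sum>k=a..<b. c k *\<^sub>R y k)"
    using large[OF \<delta>] by blast
  define s where "s = norm (\<Sum>k=a..<b. c k *\<^sub>R y k)"
  define w where "w = (\<Sum>k=a..<b. (c k / s) *\<^sub>R y k)"
  have s: "1 < s" using gt by (simp add: s_def)
  have "w = (1 / s) *\<^sub>R (\<Sum>k=a..<b. c k *\<^sub>R y k)" by (simp add: w_def scaleR_sum_right)
  then have w: "norm w = 1" using s by (simp flip: s_def)
  have "\<bar>c k / s\<bar> \<le> \<bar>c k\<bar>" for k using s by (simp add: abs_divide divide_le_eq mult_le_cancel_left1)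
  then have "\<forall>k\<in>{a..<b}. \<bar>c k / s\<bar> \<le> \<delta>" using c order_trans by blast
  then obtain v where v: "small_lift \<eta> w (\<kappa> a) (\<kappa> (Suc b)) v"
    using small[of a b "\<lambda>k. c k / s"] w by (auto simp: w_def a_def)
  have \<kappa>_ge: "k \<le> \<kappa> k" for k using \<kappa> by (rule strict_mono_imp_increasing)
  have "a < b" using w by (rule contrapos_pp) (simp add: w_def)
  then have "lo < \<kappa> (Suc b)" using \<kappa>_ge[of "Suc b"] by (simp add: a_def)
  moreover have "w \<in> span (y ` {lo..<\<kappa> (Suc b)})"
    unfolding w_def using \<kappa>_ge[of "Suc b"]
    by (intro span_sum span_scale[OF span_base]) (auto simp: a_def)
  moreover have "lo \<le> \<kappa> a" using \<kappa>_ge[of a] by (simp add: a_def)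
  then have "small_lift \<eta> w lo (\<kappa> (Suc b)) v"
    using v unfolding small_lift_def by (auto intro: supported_on_mono)
  ultimately show thesis using w by (intro that)
qed

lemma block_sequence_with_upper_c0_estimate:
  obtains lo w B where "block_sequence y lo w" "\<And>j. 1/2 \<le> norm (w j)" "upper_c0_estimate B w"
proof (cases "\<exists>\<delta>>0. \<exists>a. \<forall>b c. (\<forall>k\<in>{a..<b}. \<bar>c k\<bar> \<le> \<delta>) \<longrightarrow> norm (\<Sum>k=a..<b. c k *\<^sub>R y k) \<le> 1")
  case True
  then obtain \<delta> a where "0 < \<delta>" "\<And>b c. \<forall>k\<in>{a..<b}. \<bar>c k\<bar> \<le> \<delta> \<Longrightarrow> norm (\<Sum>k=a..<b. c k *\<^sub>R y k) \<le> 1"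
    by blast
  then have "upper_c0_estimate (1 / \<delta>) (\<lambda>j. y (a + j))" by (rule upper_c0_estimate_shift)
  moreover have "block_sequence y (\<lambda>j. a + j) (\<lambda>j. y (a + j))"
    unfolding block_sequence_def strict_mono_def by (auto intro: span_base)
  ultimately show thesis using y_ge by (intro that)
next
  case False
  define next_block where "next_block j lo hi w v \<longleftrightarrow> lo < hi \<and> w \<in> span (y ` {lo..<hi}) \<and> norm w = 1 \<and>
    small_lift ((1/2)^j / (real lo + 1)) w lo hi v" for j lo hi w v
  have "\<exists>hi. \<exists>w v. next_block j lo hi w v" for j lo
  proof -
    have "(1/2)^j \<le> real lo + 1" by (rule order_trans[OF power_le_one]) auto
    then have \<eta>: "0 < (1/2)^j / (real lo + 1)" "(1/2)^j / (real lo + 1) \<le> 1" by simp_all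
    have "\<exists>b c. (\<forall>k\<in>{a..<b}. \<bar>c k\<bar> \<le> \<delta>) \<and> 1 < norm (\<Sum>k=a..<b. c k *\<^sub>R y k)" if "0 < \<delta>" for \<delta> a
      using False that by (meson not_le)
    then show ?thesis
      by (rule normalized_block_with_small_lift[OF _ \<eta>, of lo]) (auto simp: next_block_def)
  qed
  then obtain lo where "\<And>j. \<exists>w v. next_block j (lo j) (lo (Suc j)) w v"
    using dependent_nat_choice[of "\<lambda>_ _. True" "\<lambda>j lo hi. \<exists>w v. next_block j lo hi w v"] by auto
  then obtain w v where wv: "\<And>j. next_block j (lo j) (lo (Suc j)) (w j) (v j)" by metis
  then have "strict_mono lo" by (simp add: strict_mono_Suc_iff next_block_def)
  then have "upper_c0_estimate (C * (K + 3) + 2) w"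
    using wv by (intro upper_c0_estimate_if_small_lifts[of lo w v]) (simp_all add: next_block_def)
  moreover have "block_sequence y lo w"
    using \<open>strict_mono lo\<close> wv by (simp add: block_sequence_def next_block_def)
  moreover have "1/2 \<le> norm (w j)" for j using wv[of j] by (simp add: next_block_def)
  ultimately show thesis by (intro that)
qed

lemma contains_c0_if_range_subset:
  assumes Z: "subspace Z" "closed Z" "range y \<subseteq> Z"
  shows "contains_c0 Z"
proof -
  obtain lo w B where w: "block_sequence y lo w" "\<And>j. 1/2 \<le> norm (w j)" and B: "upper_c0_estimate B w"
    by (rule block_sequence_with_upper_c0_estimate) (rule that)
  have "span (y ` A) \<subseteq> Z" for A using Z by (intro span_minimal) auto
  then have "range w \<subseteq> Z" using w(1) unfolding block_sequence_def by blast
  moreover have "1 / (4 * D) * \<bar>b i\<bar> \<le> norm (\<Sum>j<m. b j *\<^sub>R w j)" if "i < m" for m b i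
    using block_sequence_coefficient_le[OF basic w that, of b] D_pos by (simp add: field_simps)
  ultimately show ?thesis
    using Z(1,2) B D_pos by (intro contains_c0_if_c0_estimates[of Z w "1 / (4 * D)" B]) auto
qed

end

theorem theoremB:
  fixes T :: "(nat \<Rightarrow> real) \<Rightarrow> 'a::banach"
  assumes "quotient_of_schreier T"
  shows "c0_saturated (UNIV :: 'a set)"
  unfolding c0_saturated_def
proof (intro allI impI, elim conjE)
  fix Z :: "'a set" assume Z: "subspace Z" "closed Z" "infinite_dimensional Z"
  obtain C K where "schreier_quotient T C K"
    using assms by (rule schreier_quotient_if_quotient_of_schreier)
  then interpret schreier_quotient T C K .
  obtain y u pos where "schreier_blocks T C K y u pos" and y: "range y \<subseteq> Z"
    by (rule schreier_blocks_exist[OF Z(1,3)])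
  then interpret blocks: schreier_blocks T C K y u pos by simp
  obtain s where "schreier_mazur T C K (y \<circ> s) (u \<circ> s) (pos \<circ> s)"
    by (rule blocks.schreier_mazur_subsequence)
  then interpret mazur: schreier_mazur T C K "y \<circ> s" "u \<circ> s" "pos \<circ> s" .
  obtain t D \<kappa> \<phi> where "schreier_ramps T C K (y \<circ> s \<circ> t) (u \<circ> s \<circ> t) D \<kappa> \<phi>"
    by (rule mazur.schreier_ramps_subsequence)
  then interpret ramps: schreier_ramps T C K "y \<circ> s \<circ> t" "u \<circ> s \<circ> t" D \<kappa> \<phi> .
  show "contains_c0 Z" using Z(1,2) y by (intro ramps.contains_c0_if_range_subset) auto
qed

end
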